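(* Let $p$ be an odd prime and let $k\geq 1$ be an integer. There is no primitive formal-dual subset of $\mathbb{Z}/p^k\mathbb{Z}$.
   Context: Let $n\ge 1$ and $\zeta_n = e^{2\pi i/n}$. For $S\subset\mathbb{Z}/n\mathbb{Z}$, the weight enumerator of $S$ is $\nu_S\colon \mathbb{Z}/n\mathbb{Z}\to\mathbb{N}_0$, $\nu_S(y)=\#\{(v,w)\in S\times S : v-w=y\}$. Two nonempty subsets $S,T\subset \mathbb{Z}/n\mathbb{Z}$ are formally-dual to each other if $\frac{|S|^2}{|T|}\nu_T(y)=\sum_{v\in\mathbb{Z}/n\mathbb{Z}}\nu_S(v)\zeta_n^{vy}$ for every $y\in\mathbb{Z}/n\mathbb{Z}$ (this relation is symmetric in $S$ and $T$). A set $S\subset\mathbb{Z}/n\mathbb{Z}$ is formal-dual if there is a $T\subset\mathbb{Z}/n\mathbb{Z}$ such that $S$ and $T$ are formally-dual to each other. A pair of formally-dual subsets $S,T\subset\mathbb{Z}/n\mathbb{Z}$ is primitive if neither $S$ nor $T$ is contained in a coset of a proper subgroup of $\mathbb{Z}/n\mathbb{Z}$. A formal-dual subset $S$ is primitive if there is some $T\subset\mathbb{Z}/n\mathbb{Z}$ such that $S$ and $T$ form a primitive pair. *)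

theory Defs
  imports Complex_Main "HOL-Computational_Algebra.Primes" "HOL-Algebra.Elementary_Groups"
begin

text \<open>
  The group \<open>\<int>/n\<int>\<close> is the library's \<^const>\<open>integer_mod_group\<close> \<open>n\<close>. For \<open>n \<ge> 1\<close> its carrier
  is \<open>{0..<int n}\<close>, so residue classes are represented by integers. The definitions below are
  only meant for \<open>n \<ge> 1\<close> (\<open>integer_mod_group 0\<close> is the group of integers).
\<close>

definition zeta :: "nat \<Rightarrow> complex" where
  "zeta n = exp (2 * of_real pi * \<i> / of_nat n)"

definition weight_enumerator :: "nat \<Rightarrow> int set \<Rightarrow> int \<Rightarrow> nat" where
  "weight_enumerator n S y =
     card {(v, w). v \<in> S \<and> w \<in> S \<and>
       v \<otimes>\<^bsub>integer_mod_group n\<^esub> inv\<^bsub>integer_mod_group n\<^esub> w = y}"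

text \<open>The exponent \<open>v * y\<close> is a product of integer representatives; the power
  depends only on their classes modulo \<open>n\<close>.\<close>

definition formally_dual :: "nat \<Rightarrow> int set \<Rightarrow> int set \<Rightarrow> bool" where
  "formally_dual n S T \<longleftrightarrow>
     S \<noteq> {} \<and> T \<noteq> {} \<and>
     S \<subseteq> carrier (integer_mod_group n) \<and> T \<subseteq> carrier (integer_mod_group n) \<and>
     (\<forall>y \<in> carrier (integer_mod_group n).
        of_nat (card S) ^ 2 / of_nat (card T) * of_nat (weight_enumerator n T y) =
        (\<Sum>v \<in> carrier (integer_mod_group n).
           of_nat (weight_enumerator n S v) * zeta n powi (v * y)))"

definition formal_dual :: "nat \<Rightarrow> int set \<Rightarrow> bool" where
  "formal_dual n S \<longleftrightarrow> (\<exists>T. formally_dual n S T)"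

definition in_proper_coset :: "nat \<Rightarrow> int set \<Rightarrow> bool" where
  "in_proper_coset n S \<longleftrightarrow>
     (\<exists>H. subgroup H (integer_mod_group n) \<and> H \<noteq> carrier (integer_mod_group n) \<and>
          (\<exists>C \<in> rcosets\<^bsub>integer_mod_group n\<^esub> H. S \<subseteq> C))"

definition primitive_pair :: "nat \<Rightarrow> int set \<Rightarrow> int set \<Rightarrow> bool" where
  "primitive_pair n S T \<longleftrightarrow>
     formally_dual n S T \<and> \<not> in_proper_coset n S \<and> \<not> in_proper_coset n T"

definition primitive_formal_dual :: "nat \<Rightarrow> int set \<Rightarrow> bool" where
  "primitive_formal_dual n S \<longleftrightarrow> formal_dual n S \<and> (\<exists>T. primitive_pair n S T)"

end

theory Submission
  imports Defs "HOL-Computational_Algebra.Polynomial"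
begin

text \<open>
  Let \<open>(S, T)\<close> be a primitive pair in \<open>\<int>/p\<^sup>k\<close>, and let \<open>\<zeta>\<close> be a primitive \<open>p\<^sup>k\<close>-th root of unity.
  A relation \<open>\<Sum> c\<^sub>v \<zeta>\<^sup>v = 0\<close> with integer coefficients forces \<open>c\<close> to be constant on the cosets of
  the subgroup of order \<open>p\<close>. Applied to the duality relation at the units, this gives
  \<open>|S| \<le> |T|\<close>, and by symmetry \<open>|S| = |T|\<close>; moreover every unit is a difference of exactly one
  pair in \<open>S\<close>, and \<open>X = \<Sum>\<^bsub>s \<in> S\<^esub> \<zeta>\<^sup>s\<close> satisfies \<open>|X|\<^sup>2 = |S|\<close>, a power of \<open>p\<close>. As \<open>1 - \<zeta>\<close> is the only
  prime above \<open>p\<close> and is associated to its conjugate, \<open>X\<close> and its conjugate differ by a unit of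
  \<open>\<int>[\<zeta>]\<close> of modulus 1, and comparing autocorrelations shows that this unit is \<open>\<plusminus>\<zeta>\<^sup>j\<close>. Hence
  \<open>S = j - S\<close>. But then \<open>s - t = (j - t) - (j - s)\<close>, so \<open>s = j - t\<close> whenever \<open>s - t\<close> is a unit.
  This leaves only two elements in \<open>S\<close>, whereas \<open>|S|\<close> is odd.
\<close>

section \<open>Congruences of integer polynomials modulo a prime\<close>

text \<open>All inner binomial coefficients of exponent \<open>p\<close> are divisible by
  \<open>p\<close>.\<close>

lemma prime_dvd_add_power_diff:
  fixes a b :: "'a::comm_ring_1"
  assumes "prime p"
  shows "of_nat p dvd (a + b) ^ p - (a ^ p + b ^ p)"
proof -
  have p0: "p > 0" using assms prime_gt_0_nat by blast
  have split: "{..p} = insert 0 (insert p {0<..<p})" by (auto simp: p0)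
  have "(a + b) ^ p = (\<Sum>k\<le>p. of_nat (p choose k) * a ^ k * b ^ (p - k))"
    by (rule binomial_ring)
  also have "\<dots> = b ^ p + (a ^ p + (\<Sum>k\<in>{0<..<p}. of_nat (p choose k) * a ^ k * b ^ (p - k)))"
    using p0 by (subst split) simp
  finally have "(a + b) ^ p - (a ^ p + b ^ p) = (\<Sum>k\<in>{0<..<p}. of_nat (p choose k) * a ^ k * b ^ (p - k))"
    by simp
  moreover have "of_nat p dvd (of_nat (p choose k) * a ^ k * b ^ (p - k) :: 'a)" if "k \<in> {0<..<p}" for k
  proof -
    have "p dvd p choose k" using that assms by (intro dvd_choose_prime) auto
    then have "(of_nat p :: 'a) dvd of_nat (p choose k)" by (metis dvdE dvdI of_nat_mult)
    then show ?thesis by (simp add: mult.assoc)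
  qed
  ultimately show ?thesis by (metis (no_types, lifting) dvd_sum)
qed

lemma dvd_power_diff:
  fixes a b :: "'a::comm_ring_1"
  assumes "d dvd a - b"
  shows "d dvd a ^ n - b ^ n"
  using assms by (simp add: power_diff_sumr2)

lemma prime_dvd_power_self_diff:
  fixes a :: int
  assumes "prime p"
  shows "int p dvd a ^ p - a"
proof -
  \<comment> \<open>An equivalence, so that it serves both directions of the integer
    induction.\<close>
  have step: "int p dvd (x + 1) ^ p - (x + 1) \<longleftrightarrow> int p dvd x ^ p - x" for x :: int
  proof -
    have "int p dvd ((x + 1) ^ p - (x ^ p + 1 ^ p))"
      using prime_dvd_add_power_diff[OF assms, of x 1] by simp
    moreover have "(x + 1) ^ p - (x + 1) = ((x + 1) ^ p - (x ^ p + 1 ^ p)) + (x ^ p - x)" by simp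
    ultimately show ?thesis by (metis dvd_add_right_iff)
  qed
  show ?thesis
  proof (induction a rule: int_induct[where k = 0])
    case base
    then show ?case using prime_gt_0_nat[OF assms] by (simp add: power_0_left)
  next
    case (step1 i)
    then show ?case using step by blast
  next
    case (step2 i)
    then show ?case using step[of "i - 1"] by simp
  qed
qed

text \<open>The Frobenius congruence \<open>h(x) ^ p \<equiv> h(x ^ p)\<close> modulo
  \<open>p\<close>. It is compatible with sums and with multiplication by \<open>x\<close>; Fermat's
  little theorem handles the coefficients.\<close>

lemma prime_dvd_poly_power_diff_pcompose:
  fixes h :: "int poly"
  assumes "prime p"
  shows "of_nat p dvd h ^ p - pcompose h (monom 1 p)"
proof (induction h)
  case 0
  then show ?case using prime_gt_0_nat[OF assms] by (simp add: power_0_left)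
next
  case (pCons a h)
  have eq: "pCons a h = [:a:] + [:0, 1:] * h" by simp
  have "of_nat p dvd (pCons a h) ^ p - ([:a:] ^ p + ([:0, 1:] * h) ^ p)"
    unfolding eq by (rule prime_dvd_add_power_diff[OF assms])
  moreover have "([:0, 1:] * h) ^ p = monom 1 p * h ^ p"
    by (simp only: power_mult_distrib monom_altdef smult_1_left)
  ultimately have 1: "of_nat p dvd (pCons a h) ^ p - ([:a:] ^ p + monom 1 p * h ^ p)" by simp
  have "[:a:] ^ p - [:a:] = [:a ^ p - a:]" by (simp add: poly_const_pow)
  moreover have "(of_nat p :: int poly) = [:int p:]" by (simp add: of_nat_poly)
  ultimately have 2: "of_nat p dvd [:a:] ^ p - [:a:]"
    using prime_dvd_power_self_diff[OF assms, of a]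
    by (simp add: const_poly_dvd_iff coeff_pCons split: nat.splits)
  have 3: "of_nat p dvd monom 1 p * (h ^ p - pcompose h (monom 1 p))"
    using pCons.IH by (rule dvd_mult)
  have sum: "(pCons a h) ^ p - pcompose (pCons a h) (monom 1 p) =
     ((pCons a h) ^ p - ([:a:] ^ p + monom 1 p * h ^ p)) + ([:a:] ^ p - [:a:]) +
     monom 1 p * (h ^ p - pcompose h (monom 1 p))"
    unfolding pcompose_pCons right_diff_distrib by (simp only: diff_add_eq diff_diff_eq add_diff_eq)
  show ?case unfolding sum by (intro dvd_add 1 2 3)
qed

lemma pcompose_monom_monom:
  "pcompose (monom 1 a) (monom 1 b) = monom (1 :: 'a::comm_semiring_1) (a * b)"
  by (induction a) (simp_all add: monom_0 monom_Suc pcompose_pCons mult_monom)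

lemma prime_dvd_poly_prime_power_diff_pcompose:
  fixes h :: "int poly"
  assumes "prime p"
  shows "of_nat p dvd h ^ (p ^ k) - pcompose h (monom 1 (p ^ k))"
proof (induction k)
  case 0
  then show ?case by (simp add: monom_altdef)
next
  case (Suc k)
  let ?g = "pcompose h (monom 1 (p ^ k))"
  have "of_nat p dvd (h ^ (p ^ k)) ^ p - ?g ^ p"
    by (rule dvd_power_diff[OF Suc.IH])
  moreover have "of_nat p dvd ?g ^ p - pcompose ?g (monom 1 p)"
    by (rule prime_dvd_poly_power_diff_pcompose[OF assms])
  moreover have "pcompose ?g (monom 1 p) = pcompose h (monom 1 (p ^ Suc k))"
  proof -
    have "pcompose (monom (1::int) (p ^ k)) (monom 1 p) = monom 1 (p ^ Suc k)"
      by (simp add: pcompose_monom_monom mult.commute)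
    then show ?thesis by (metis pcompose_assoc)
  qed
  ultimately have "of_nat p dvd ((h ^ (p ^ k)) ^ p - ?g ^ p) + (?g ^ p - pcompose h (monom 1 (p ^ Suc k)))"
    by (simp only: dvd_add)
  moreover have "h ^ (p ^ Suc k) = (h ^ (p ^ k)) ^ p"
    by (metis power_Suc2 power_mult)
  ultimately show ?case by simp
qed

text \<open>Modulo \<open>p\<close>, \<open>h\<close> divides the nonzero constant \<open>m\<close>,
  so it is constant there; its leading coefficient survives the reduction, so \<open>h\<close>
  itself is constant. The proof stays over the integers: a leading term of \<open>A\<close>
  divisible by \<open>p\<close> is moved into \<open>r\<close>.\<close>

lemma degree_eq_0_if_unit_mod_prime:
  fixes h A r :: "int poly"
  assumes "prime (int p)" "\<not> int p dvd lead_coeff h" "\<not> int p dvd m"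
    and "h * A = [:m:] + of_nat p * r"
  shows "degree h = 0"
  using assms(4)
\<comment> \<open>The length also drops when a constant \<open>A\<close> is replaced by 0, where the
  degree would not.\<close>
proof (induction "length (coeffs A)" arbitrary: A r rule: less_induct)
  case less
  have ofp: "(of_nat p :: int poly) = [:int p:]" by (simp add: of_nat_poly)
  have cf: "coeff (h * A) i = (if i = 0 then m else 0) + int p * coeff r i" for i
    using less.prems by (simp add: ofp coeff_pCons split: nat.splits)
  show ?case
  proof (cases "A = 0")
    case True
    then have "m = int p * (- coeff r 0)" using cf[of 0] by simp
    then show ?thesis using assms(3) by (metis dvd_triv_left)
  next
    case False
    show ?thesis
    proof (cases "int p dvd lead_coeff A")
      case True
      then obtain c where c: "lead_coeff A = int p * c" by blast
      define B where "B = A - monom (lead_coeff A) (degree A)"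
      have "length (coeffs B) < length (coeffs A)"
      proof (cases "B = 0")
        case True
        then show ?thesis using False by simp
      next
        case nz: False
        have "degree B < degree A"
        proof -
          have "degree B \<le> degree A" unfolding B_def
            by (intro degree_diff_le) (simp_all add: degree_monom_le)
          moreover have "coeff B (degree A) = 0" by (simp add: B_def)
          ultimately show ?thesis using nz
            by (metis le_neq_implies_less leading_coeff_0_iff)
        qed
        then show ?thesis using nz False by (simp add: length_coeffs_degree)
      qed
      moreover have "h * B = [:m:] + of_nat p * (r - h * monom c (degree A))"
      proof -
        have "monom (lead_coeff A) (degree A) = of_nat p * monom c (degree A)"
          by (simp add: c ofp smult_monom)
        then show ?thesis using less.prems by (simp add: B_def algebra_simps)
      qed
      ultimately show ?thesis using less.hyps by blast
    next
      case 2: False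
      have "coeff (h * A) (degree h + degree A) = lead_coeff h * lead_coeff A"
        by (rule coeff_mult_degree_sum)
      moreover have "\<not> int p dvd lead_coeff h * lead_coeff A"
        using assms(1,2) 2 prime_dvd_mult_iff by blast
      moreover have "int p dvd coeff (h * A) i" if "i \<noteq> 0" for i
        unfolding cf using that by simp
      ultimately have "degree h + degree A = 0" by metis
      then show ?thesis by simp
    qed
  qed
qed

text \<open>This takes the place of an irreducibility criterion. Modulo \<open>h\<close> one has
  \<open>x ^ (p ^ k) \<equiv> 1\<close>, hence \<open>h(x ^ (p ^ k)) \<equiv> h(1)\<close>; modulo
  \<open>p\<close> the same polynomial is \<open>h ^ (p ^ k)\<close>. So modulo \<open>p\<close> the
  polynomial \<open>h\<close> divides \<open>h(1)\<close>, a nonzero constant.\<close>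

lemma degree_eq_0_if_dvd_monom_prime_power_diff:
  fixes h :: "int poly"
  assumes "prime p" and "h dvd monom 1 (p ^ k) - 1" and "\<not> int p dvd poly h 1"
  shows "degree h = 0"
proof -
  let ?x = "monom (1::int) (p ^ k)"
  have n0: "p ^ k > 0" using prime_gt_0_nat[OF assms(1)] by simp
  obtain w where w: "?x - 1 = h * w" using assms(2) by blast
  have "lead_coeff h * lead_coeff w = 1"
  proof -
    have "degree (?x - 1) = p ^ k"
      using n0 by (intro antisym degree_diff_le le_degree) (auto simp: degree_monom_eq)
    then have "lead_coeff (?x - 1) = 1" using n0 by simp
    then show ?thesis by (simp add: w lead_coeff_mult)
  qed
  then have lc: "lead_coeff h dvd 1" by (metis dvd_triv_left)
  have pp: "prime (int p)" using assms(1) by simp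
  have ndvd: "\<not> int p dvd lead_coeff h"
    using lc pp not_prime_unit dvd_trans by blast
  \<comment> \<open>Substituting \<open>x ^ (p ^ k)\<close> for \<open>x\<close> turns the factor
    \<open>x - 1\<close> into a multiple of \<open>h\<close>.\<close>
  have "[:-1, 1:] dvd h - [:poly h 1:]"
    by (simp add: poly_eq_0_iff_dvd[symmetric])
  then obtain c where "h - [:poly h 1:] = [:-1, 1:] * c" by blast
  then have "pcompose (h - [:poly h 1:]) ?x = pcompose ([:-1, 1:] * c) ?x" by simp
  then have c: "pcompose h ?x - [:poly h 1:] = h * (w * pcompose c ?x)"
    by (simp add: pcompose_diff pcompose_mult pcompose_pCons w[symmetric] mult.assoc[symmetric])
       (simp add: one_pCons algebra_simps)
  obtain r where r: "h ^ (p ^ k) - pcompose h ?x = of_nat p * r"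
    using prime_dvd_poly_prime_power_diff_pcompose[OF assms(1), of h k] by blast
  have "h * (h ^ (p ^ k - 1) - w * pcompose c ?x) = h ^ (p ^ k) - h * (w * pcompose c ?x)"
    using n0 by (simp add: right_diff_distrib power_minus_mult mult.commute flip: power_Suc)
  also have "\<dots> = [:poly h 1:] + of_nat p * r" using c r by (simp add: algebra_simps)
  finally have eq: "h * (h ^ (p ^ k - 1) - w * pcompose c ?x) = [:poly h 1:] + of_nat p * r" .
  show ?thesis by (rule degree_eq_0_if_unit_mod_prime[OF pp ndvd assms(3) eq])
qed

section \<open>Relations between roots of unity of prime power order\<close>

lemma map_poly_of_int_add:
  "map_poly of_int (f + g) = map_poly of_int f + (map_poly of_int g :: 'a::comm_ring_1 poly)"
  by (rule poly_eqI) (simp add: coeff_map_poly)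

lemma map_poly_of_int_diff:
  "map_poly of_int (f - g) = map_poly of_int f - (map_poly of_int g :: 'a::comm_ring_1 poly)"
  by (rule poly_eqI) (simp add: coeff_map_poly)

lemma map_poly_of_int_mult:
  "map_poly of_int (f * g) = map_poly of_int f * (map_poly of_int g :: 'a::comm_ring_1 poly)"
  by (rule poly_eqI) (simp add: coeff_map_poly coeff_mult)

lemma map_poly_of_int_power:
  "map_poly of_int (f ^ k) = (map_poly of_int f :: 'a::comm_ring_1 poly) ^ k"
  by (induction k) (simp_all add: map_poly_of_int_mult map_poly_1')

lemma map_poly_of_int_sum:
  "map_poly of_int (sum f A) = (\<Sum>x\<in>A. map_poly of_int (f x) :: 'a::comm_ring_1 poly)"
  by (rule poly_eqI) (simp add: coeff_map_poly coeff_sum)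

text \<open>For fixed \<open>z\<close> the values form the ring \<open>\<int>[z]\<close>;
  divisibility in it is expressed by exhibiting a polynomial for the cofactor.\<close>

definition ieval :: "int poly \<Rightarrow> complex \<Rightarrow> complex" where
  "ieval f z = poly (map_poly of_int f) z"

lemma ieval_0 [simp]: "ieval 0 z = 0"
  and ieval_1 [simp]: "ieval 1 z = 1"
  and ieval_const [simp]: "ieval [:c:] z = of_int c"
  and ieval_of_nat [simp]: "ieval (of_nat k) z = of_nat k"
  and ieval_add [simp]: "ieval (f + g) z = ieval f z + ieval g z"
  and ieval_diff [simp]: "ieval (f - g) z = ieval f z - ieval g z"
  and ieval_mult [simp]: "ieval (f * g) z = ieval f z * ieval g z"
  and ieval_power [simp]: "ieval (f ^ k) z = ieval f z ^ k"
  and ieval_monom [simp]: "ieval (monom c k) z = of_int c * z ^ k"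
  and ieval_smult [simp]: "ieval (smult c f) z = of_int c * ieval f z"
  and ieval_sum: "ieval (sum h A) z = (\<Sum>x\<in>A. ieval (h x) z)"
  by (simp_all add: ieval_def map_poly_of_int_add map_poly_of_int_diff map_poly_of_int_mult
        map_poly_of_int_power map_poly_of_int_sum map_poly_monom map_poly_pCons map_poly_1'
        poly_monom poly_sum map_poly_smult of_nat_poly)

lemma ieval_minus [simp]: "ieval (- f) z = - ieval f z"
  using ieval_diff[of 0 f z] by simp

lemma ieval_pCons [simp]: "ieval (pCons c f) z = of_int c + z * ieval f z"
  by (simp add: ieval_def map_poly_pCons)

lemma ieval_pcompose: "ieval (pcompose f g) z = ieval f (ieval g z)"
  by (induction f) (simp_all add: pcompose_pCons)

lemma cnj_ieval: "cnj (ieval f z) = ieval f (cnj z)"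
  by (induction f) simp_all

section \<open>The minimal polynomial of a root of unity of exact order
  \<open>p ^ Suc m\<close>\<close>

locale prime_power_root =
  fixes p m :: nat and z :: complex
  assumes prime_p: "prime p" and root: "z ^ (p ^ Suc m) = 1" and nonroot: "z ^ (p ^ m) \<noteq> 1"
begin

definition n :: nat where "n = p ^ Suc m"
definition q :: nat where "q = p ^ m"

text \<open>The cyclotomic polynomial of index \<open>n\<close>, as a geometric sum in
  \<open>x ^ q\<close>.\<close>

definition cyclo :: "int poly" where
  "cyclo = (\<Sum>i<p. monom 1 q ^ i)"

lemma p_gt_1: "p > 1" using prime_p prime_gt_1_nat by blast

lemma n_pos: "n > 0" and q_pos: "q > 0" and q_lt_n: "q < n"
  using p_gt_1 by (simp_all add: n_def q_def)

lemma n_eq: "n = p * q"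
  by (simp add: n_def q_def)

lemma z_power_n: "z ^ n = 1" and z_power_q: "z ^ q \<noteq> 1"
  using root nonroot by (simp_all only: n_def q_def not_False_eq_True)

lemma monom_diff_mult_cyclo: "(monom 1 q - 1) * cyclo = monom 1 n - 1"
proof -
  have "monom (1 :: int) n = monom 1 q ^ p" by (simp add: monom_power n_eq mult.commute)
  then show ?thesis by (simp add: cyclo_def power_diff_1_eq)
qed

lemma poly_cyclo_1: "poly cyclo 1 = int p"
  by (simp add: cyclo_def poly_sum poly_monom poly_power)

lemma ieval_cyclo: "ieval cyclo z = 0"
proof -
  have "ieval ((monom 1 q - 1) * cyclo) z = 0"
    by (simp only: monom_diff_mult_cyclo) (simp add: z_power_n)
  then show ?thesis using z_power_q by simp
qed

text \<open>A primitive annihilator \<open>g\<close> of least degree divides every annihilator, so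
  \<open>cyclo = g * h\<close> with \<open>g(1) * h(1) = p\<close>. As \<open>g\<close> is not
  constant, \<open>p\<close> divides \<open>g(1)\<close>; then \<open>h(1)\<close> is a unit, so
  \<open>h\<close> is a constant unit and \<open>cyclo\<close> divides whatever \<open>g\<close>
  divides.\<close>

lemma cyclo_dvd_of_ieval_eq_0:
  assumes "ieval f z = 0"
  shows "cyclo dvd f"
proof -
  define P where "P = (\<lambda>f::int poly. f \<noteq> 0 \<and> ieval f z = 0)"
  have "cyclo \<noteq> 0" using poly_cyclo_1 p_gt_1 by auto
  then have "P cyclo" by (simp add: P_def ieval_cyclo)
  then obtain g0 where g0: "P g0" "\<And>h. P h \<Longrightarrow> degree g0 \<le> degree h"
    using ex_has_least_nat[of P cyclo degree] by blast
  define g where "g = primitive_part g0"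
  have g0_eq: "g0 = smult (content g0) g" by (simp add: g_def)
  have cg: "content g = 1" using g0(1) by (simp add: g_def P_def)
  have g_nz: "g \<noteq> 0" using cg by auto
  have evg: "ieval g z = 0"
  proof -
    have "of_int (content g0) * ieval g z = 0" using g0(1) g0_eq by (metis P_def ieval_smult)
    then show ?thesis using g0(1) by (simp add: P_def)
  qed
  have g_min: "degree g \<le> degree h" if "P h" for h
    using g0(2)[OF that] by (simp add: g_def)
  have g_dvd: "g dvd h" if h: "ieval h z = 0" for h
  proof -
    \<comment> \<open>Pseudo-division costs a multiplier \<open>a\<close>. The remainder vanishes by
      minimality, and since \<open>g\<close> has content 1, Gauss's lemma lets \<open>a\<close> be
      cancelled.\<close>
    obtain a b where ab: "a \<noteq> 0" "smult a h = g * b + pseudo_mod h g"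
      and deg: "pseudo_mod h g = 0 \<or> degree (pseudo_mod h g) < degree g"
      using pseudo_mod[OF g_nz, of h] by blast
    have "ieval (pseudo_mod h g) z = 0"
      using arg_cong[OF ab(2), of "\<lambda>f. ieval f z"] h evg by simp
    then have "pseudo_mod h g = 0" using g_min[of "pseudo_mod h g"] deg by (force simp: P_def)
    then have eq: "smult a h = g * b" using ab(2) by simp
    then have "content b = normalize a * content h" by (metis cg content_mult content_smult mult_1)
    then have "a dvd content b" by (metis dvd_triv_left normalize_dvd_iff)
    then have "[:a:] dvd b" by (simp add: const_poly_dvd_iff_dvd_content)
    then obtain b' where "b = smult a b'" by (auto elim!: dvdE)
    then have "smult a h = smult a (g * b')" using eq by simp
    then have "h = g * b'" using ab(1) by (metis smult_eq_iff smult_cancel)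
    then show ?thesis by simp
  qed
  then obtain h where h: "cyclo = g * h" using ieval_cyclo by blast
  have cyclo_dvd_x: "cyclo dvd monom 1 n - 1"
    by (metis monom_diff_mult_cyclo dvd_triv_right)
  have prod1: "poly g 1 * poly h 1 = int p"
    using poly_cyclo_1 h by simp
  have "degree g \<noteq> 0"
  proof
    assume "degree g = 0"
    then obtain c where "g = [:c:]" using degree_eq_zeroE by blast
    then show False using evg g_nz by simp
  qed
  moreover have "g dvd monom 1 n - 1" using h cyclo_dvd_x by (metis dvd_mult_left)
  ultimately have "int p dvd poly g 1"
    using degree_eq_0_if_dvd_monom_prime_power_diff[OF prime_p, of g "Suc m", folded n_def] by metis
  then obtain g' where g': "poly g 1 = int p * g'" by blast
  then have unit: "g' * poly h 1 = 1" using prod1 p_gt_1 by (simp add: mult.assoc)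
  have "\<not> int p dvd poly h 1"
  proof
    assume "int p dvd poly h 1"
    then have "int p dvd 1" using unit by (metis dvd_mult)
    then show False using p_gt_1 by simp
  qed
  moreover have "h dvd monom 1 n - 1" using h cyclo_dvd_x by (metis dvd_mult_right)
  ultimately have "degree h = 0"
    using degree_eq_0_if_dvd_monom_prime_power_diff[OF prime_p, of h "Suc m", folded n_def] by metis
  then obtain c where c: "h = [:c:]" using degree_eq_zeroE by blast
  have "h * [:g':] = 1" using unit by (simp add: c one_pCons mult.commute)
  then have "cyclo * [:g':] = g" unfolding h by (simp only: mult.assoc mult_1_right)
  then have "cyclo dvd g" by (metis dvd_triv_left)
  then show ?thesis using g_dvd[OF assms] dvd_trans by blast
qed

text \<open>Hence \<open>poly f 1\<close> modulo \<open>p\<close> depends only on the value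
  \<open>ieval f z\<close>: this is reduction of \<open>\<int>[z]\<close> modulo
  \<open>1 - z\<close>.\<close>

lemma prime_dvd_poly_1_of_ieval_eq_0:
  assumes "ieval f z = 0"
  shows "int p dvd poly f 1"
proof -
  obtain h where "f = cyclo * h" using cyclo_dvd_of_ieval_eq_0[OF assms] by blast
  then show ?thesis using poly_cyclo_1 by simp
qed

text \<open>With \<open>f = cyclo * h\<close>, multiplying by \<open>x ^ q - 1\<close> gives
  \<open>(x ^ q - 1) * f = (x ^ n - 1) * h\<close>; compare the coefficients at
  \<open>i + q\<close>.\<close>

lemma coeff_eq_of_ieval_eq_0:
  assumes "ieval f z = 0" "degree f < n" "i + q < n"
  shows "coeff f (i + q) = coeff f i"
proof -
  obtain h where h: "f = cyclo * h" using cyclo_dvd_of_ieval_eq_0[OF assms(1)] by blast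
  have eq: "(monom 1 q - 1) * f = (monom 1 n - 1) * h"
    by (simp only: h mult.assoc[symmetric] monom_diff_mult_cyclo)
  have degx: "degree (monom (1::int) k - 1) = k" if "k > 0" for k
    using that by (intro antisym degree_diff_le le_degree) (auto simp: degree_monom_eq)
  \<comment> \<open>Comparing degrees in \<open>eq\<close> shows
    \<open>degree h < q\<close>.\<close>
  have h0: "coeff h (i + q) = 0"
  proof (cases "h = 0")
    case False
    then have "f \<noteq> 0" using h poly_cyclo_1 p_gt_1 by auto
    have nz: "monom (1::int) k - 1 \<noteq> 0" if "k > 0" for k using degx[OF that] that by auto
    have "q + degree f = n + degree h"
      using arg_cong[OF eq, of degree] degx[OF q_pos] degx[OF n_pos] nz[OF q_pos] nz[OF n_pos] False \<open>f \<noteq> 0\<close>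
      by (simp add: degree_mult_eq)
    then show ?thesis using assms(2) by (intro coeff_eq_0) linarith
  qed simp
  have "coeff ((monom 1 q - 1) * f) (i + q) = coeff f i - coeff f (i + q)"
    by (simp add: left_diff_distrib coeff_monom_mult)
  moreover have "coeff ((monom 1 n - 1) * h) (i + q) = - coeff h (i + q)"
    using assms(3) by (simp add: left_diff_distrib coeff_monom_mult)
  ultimately show ?thesis using eq h0 by simp
qed

end

section \<open>Elements of modulus 1\<close>

definition periodic :: "int \<Rightarrow> (int \<Rightarrow> 'a) \<Rightarrow> bool" where
  "periodic N f \<longleftrightarrow> (\<forall>v. f (v mod N) = f v)"

lemma periodicD: "periodic N f \<Longrightarrow> f (v mod N) = f v"
  by (simp add: periodic_def)

lemma periodic_cong: "periodic N f \<Longrightarrow> u mod N = v mod N \<Longrightarrow> f u = f v"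
  by (metis periodicD)

lemma periodicI: "(\<And>u v. u mod N = v mod N \<Longrightarrow> f u = f v) \<Longrightarrow> periodic N f"
  unfolding periodic_def by (meson mod_mod_trivial)

lemma periodic_shift: "periodic N f \<Longrightarrow> periodic N (\<lambda>v. f (v + d))"
  by (rule periodicI) (metis mod_add_left_eq periodicD)

lemma sum_periodic_shift:
  fixes f :: "int \<Rightarrow> 'a::comm_monoid_add"
  assumes "periodic N f" "N > 0"
  shows "(\<Sum>v\<in>{0..<N}. f (v + d)) = (\<Sum>v\<in>{0..<N}. f v)"
proof -
  have "bij_betw (\<lambda>v. (v + d) mod N) {0..<N} {0..<N}"
    using assms(2) by (intro bij_betw_byWitness[where f' = "\<lambda>v. (v - d) mod N"])
      (auto simp: mod_simps)
  then have "(\<Sum>v\<in>{0..<N}. f ((v + d) mod N)) = (\<Sum>v\<in>{0..<N}. f v)"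
    by (rule sum.reindex_bij_betw)
  then show ?thesis using assms(1) by (simp add: periodicD)
qed

lemma sum_periodic_reflect:
  fixes f :: "int \<Rightarrow> 'a::comm_monoid_add"
  assumes "periodic N f" "N > 0"
  shows "(\<Sum>v\<in>{0..<N}. f (d - v)) = (\<Sum>v\<in>{0..<N}. f v)"
proof -
  have "bij_betw (\<lambda>v. (d - v) mod N) {0..<N} {0..<N}"
    using assms(2) by (intro bij_betw_byWitness[where f' = "\<lambda>v. (d - v) mod N"])
      (auto simp: mod_simps)
  then have "(\<Sum>v\<in>{0..<N}. f ((d - v) mod N)) = (\<Sum>v\<in>{0..<N}. f v)"
    by (rule sum.reindex_bij_betw)
  then show ?thesis using assms(1) by (simp add: periodicD)
qed

text \<open>A nonzero integer function with sum 0 takes both signs, and one value of each sign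
  already uses up the sum of squares.\<close>

lemma sum_zero_sum_squares_two:
  fixes f :: "'a \<Rightarrow> int"
  assumes "finite I" "sum f I = 0" "(\<Sum>x\<in>I. (f x)\<^sup>2) = 2"
  obtains a b where "a \<in> I" "b \<in> I" "a \<noteq> b" "f a = 1" "f b = -1"
    "\<And>x. x \<in> I \<Longrightarrow> x \<noteq> a \<Longrightarrow> x \<noteq> b \<Longrightarrow> f x = 0"
proof -
  have nz: "\<exists>x\<in>I. f x \<noteq> 0"
  proof (rule ccontr)
    assume "\<not> (\<exists>x\<in>I. f x \<noteq> 0)"
    then have "(\<Sum>x\<in>I. (f x)\<^sup>2) = 0" by simp
    then show False using assms(3) by simp
  qed
  have "\<exists>a\<in>I. f a > 0"
  proof (rule ccontr)
    assume "\<not> (\<exists>a\<in>I. f a > 0)"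
    then have "\<forall>x\<in>I. f x = 0" using sum_nonneg_eq_0_iff[OF assms(1), of "\<lambda>x. - f x"] assms(2)
      by (auto simp: not_less sum_negf)
    then show False using nz by blast
  qed
  then obtain a where a: "a \<in> I" "f a > 0" by blast
  have "\<exists>b\<in>I. f b < 0"
  proof (rule ccontr)
    assume "\<not> (\<exists>b\<in>I. f b < 0)"
    then have "\<forall>x\<in>I. f x = 0" using sum_nonneg_eq_0_iff[OF assms(1), of f] assms(2)
      by (auto simp: not_less)
    then show False using nz by blast
  qed
  then obtain b where b: "b \<in> I" "f b < 0" by blast
  have ab: "a \<noteq> b" using a b by auto
  have "(\<Sum>x\<in>I. (f x)\<^sup>2) = (f a)\<^sup>2 + ((f b)\<^sup>2 + (\<Sum>x\<in>I - {a} - {b}. (f x)\<^sup>2))"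
    using assms(1) a b ab by (subst sum.remove[of _ a], simp, simp, subst sum.remove[of _ b]) auto
  moreover have sq: "(f a)\<^sup>2 \<ge> f a" "(f b)\<^sup>2 \<ge> - f b"
    using a self_le_power[of "f a" 2] b self_le_power[of "- f b" 2] by simp_all
  moreover have ge: "(\<Sum>x\<in>I - {a} - {b}. (f x)\<^sup>2) \<ge> 0" by (rule sum_nonneg) simp
  ultimately have "f a = 1" "f b = -1" and rest: "(\<Sum>x\<in>I - {a} - {b}. (f x)\<^sup>2) = 0"
    using assms(3) a b by linarith+
  moreover have "f x = 0" if "x \<in> I" "x \<noteq> a" "x \<noteq> b" for x
    using rest assms(1) that by (subst (asm) sum_nonneg_eq_0_iff) auto
  ultimately show ?thesis using that a b ab by blast
qed

section \<open>Group ring elements evaluated at the root\<close>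

context prime_power_root
begin

abbreviation I :: "int set" where "I \<equiv> {0..<int n}"

text \<open>The image of the group ring element with coefficients \<open>c\<close> under the
  character \<open>v \<mapsto> z powi v\<close>.\<close>

definition fsum :: "(int \<Rightarrow> int) \<Rightarrow> complex" where
  "fsum c = (\<Sum>v\<in>I. of_int (c v) * z powi v)"

lemma int_n_pos: "int n > 0" using n_pos by simp

lemma z_nz: "z \<noteq> 0" using z_power_n n_pos by (auto simp: power_0_left)

lemma norm_z: "norm z = 1"
  using power_eq_1_iff[OF z_power_n] n_pos by simp

lemma cnj_z: "cnj z = inverse z"
proof -
  have "z * cnj z = 1" using norm_z by (simp add: complex_norm_square[symmetric])
  then show ?thesis by (simp add: inverse_unique)
qed

lemma cnj_z_powi: "cnj (z powi v) = z powi (- v)"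
  by (simp add: cnj_z power_int_inverse power_int_minus)

lemma periodic_z_powi: "periodic (int n) (\<lambda>v. z powi v)"
  unfolding periodic_def
proof
  fix v :: int
  have "z powi v = z powi (int n * (v div int n) + v mod int n)" by simp
  also have "\<dots> = (z powi int n) powi (v div int n) * z powi (v mod int n)"
    using z_nz by (subst power_int_add) (simp_all add: power_int_mult)
  also have "z powi int n = 1" using z_power_n by (simp only: power_int_of_nat)
  finally show "z powi (v mod int n) = z powi v" by simp
qed

lemma z_powi_cong: "u mod int n = v mod int n \<Longrightarrow> z powi u = z powi v"
  using periodic_cong[OF periodic_z_powi] .

lemma z_powi_add: "z powi (u + v) = z powi u * z powi v"
  using z_nz by (simp add: power_int_add)

lemma periodic_term: "periodic (int n) c \<Longrightarrow> periodic (int n) (\<lambda>v. of_int (c v) * z powi v)"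
  by (rule periodicI) (metis periodic_cong z_powi_cong)

lemma fsum_diff: "fsum (\<lambda>v. c v - d v) = fsum c - fsum d"
  by (simp add: fsum_def sum_subtractf left_diff_distrib)

lemma fsum_add: "fsum (\<lambda>v. c v + d v) = fsum c + fsum d"
  by (simp add: fsum_def sum.distrib distrib_right)

lemma fsum_cmult: "fsum (\<lambda>v. a * c v) = of_int a * fsum c"
  by (simp add: fsum_def sum_distrib_left mult.assoc)

definition delta :: "int \<Rightarrow> int \<Rightarrow> int" where
  "delta a v = (if v mod int n = a mod int n then 1 else 0)"

lemma periodic_delta: "periodic (int n) (delta a)"
  by (simp add: periodic_def delta_def)

lemma fsum_delta: "fsum (delta a) = z powi a"
proof -
  have "fsum (delta a) = (\<Sum>v\<in>I. if v = a mod int n then z powi v else 0)"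
    unfolding fsum_def by (rule sum.cong) (auto simp: delta_def)
  also have "\<dots> = z powi (a mod int n)" using int_n_pos by (simp add: sum.delta)
  also have "\<dots> = z powi a" by (rule z_powi_cong) simp
  finally show ?thesis .
qed

lemma fsum_shift:
  assumes "periodic (int n) c"
  shows "fsum (\<lambda>v. c (v - d)) = z powi d * fsum c"
proof -
  have "periodic (int n) (\<lambda>v. c (v - d))" using periodic_shift[OF assms, of "- d"] by simp
  from sum_periodic_shift[OF periodic_term[OF this] int_n_pos, of d]
  have "fsum (\<lambda>v. c (v - d)) = (\<Sum>v\<in>I. of_int (c ((v + d) - d)) * z powi (v + d))"
    unfolding fsum_def by simp
  then show ?thesis by (simp add: fsum_def z_powi_add sum_distrib_left mult_ac)
qed

text \<open>Shifting by \<open>q\<close> fixes \<open>c\<close> but multiplies the sum by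
  \<open>z ^ q\<close>, which is not 1.\<close>

lemma fsum_eq_0:
  assumes "periodic (int n) c" "\<And>v. c (v + int q) = c v"
  shows "fsum c = 0"
proof -
  have "fsum c = fsum (\<lambda>v. c (v - int q))" using assms(2)[of "v - int q" for v] by simp
  also have "\<dots> = z ^ q * fsum c" using fsum_shift[OF assms(1)] by (simp only: power_int_of_nat)
  finally show ?thesis using z_power_q by simp
qed

text \<open>The values of \<open>c\<close> on \<open>I\<close> are the coefficients of a polynomial
  of degree below \<open>n\<close> vanishing at \<open>z\<close>, so the comparison of coefficients
  at distance \<open>q\<close> applies.\<close>

lemma q_periodic_if_fsum_eq_0:
  assumes "periodic (int n) c" "fsum c = 0"
  shows "c (v + int q * t) = c v"
proof -
  define f where "f = (\<Sum>i<n. monom (c (int i)) i)"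
  have cf: "coeff f i = (if i < n then c (int i) else 0)" for i
    by (simp add: f_def coeff_sum)
  have ev: "ieval f z = 0"
  proof -
    have "fsum c = (\<Sum>i<n. of_int (c (int i)) * z powi (int i))"
      unfolding fsum_def
      by (rule sum.reindex_bij_witness[of _ int nat]) auto
    then show ?thesis using assms(2) by (simp add: f_def ieval_sum)
  qed
  have deg: "degree f < n"
    by (rule degree_lessI) (auto simp: cf n_pos)
  have chain: "coeff f (j + s * q) = coeff f j" if "j + s * q < n" for j s
    using that
  proof (induction s)
    case (Suc s)
    then show ?case using coeff_eq_of_ieval_eq_0[OF ev deg, of "j + s * q"] by (simp add: algebra_simps)
  qed simp
  have cv: "c u = coeff f (nat (u mod int n))" for u
    using int_n_pos periodicD[OF assms(1), of u] by (simp add: cf nat_less_iff)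
  have step: "c (u + int q) = c u" for u
  proof -
    define i where "i = nat (u mod int n)"
    have i: "i < n" "int i = u mod int n" using int_n_pos by (simp_all add: i_def nat_less_iff)
    have "(u + int q) mod int n = (int i + int q) mod int n" by (simp only: i(2) mod_simps)
    then have eq: "nat ((u + int q) mod int n) = (i + q) mod n"
      by (metis nat_int of_nat_add of_nat_mod)
    show ?thesis
    proof (cases "i + q < n")
      case True
      then show ?thesis using cv[of u] cv[of "u + int q"] eq chain[of i 1] by (simp add: i_def)
    next
      case False
      \<comment> \<open>The step from \<open>i\<close> wraps around to \<open>j = i + q - n\<close>.
        Both lie on one chain inside the range, \<open>j\<close> as its first and \<open>i\<close>
        as its last member, \<open>p - 1\<close> steps apart.\<close>
      have n_eq: "n = q + (p - 1) * q" using p_gt_1 by (simp add: n_eq algebra_simps)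
      define j where "j = i + q - n"
      have j: "j + (p - 1) * q = i" "(i + q) mod n = j"
        using False n_eq i(1) q_lt_n by (auto simp: j_def mod_if)
      then have "coeff f i = coeff f j" using chain[of j "p - 1"] i(1) by simp
      then show ?thesis using cv[of u] cv[of "u + int q"] eq j(2) by (simp add: i_def)
    qed
  qed
  show ?thesis
  proof (induction t rule: int_induct[where k = 0])
    case (step1 i)
    then show ?case using step[of "v + int q * i"] by (simp add: algebra_simps)
  next
    case (step2 i)
    then show ?case using step[of "v + int q * (i - 1)"] by (simp add: algebra_simps)
  qed simp
qed

text \<open>Multiplication by \<open>z\<close> is a shift of the coefficients, so every element of
  \<open>\<int>[z]\<close> comes from the group ring.\<close>

lemma ieval_eq_fsum: "\<exists>c. periodic (int n) c \<and> ieval f z = fsum c"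
proof (induction f)
  case 0
  have "ieval 0 z = fsum (\<lambda>_. 0)" by (simp add: fsum_def)
  then show ?case by (intro exI[of _ "\<lambda>_. 0"]) (simp add: periodic_def)
next
  case (pCons a f)
  then obtain c where c: "periodic (int n) c" "ieval f z = fsum c" by blast
  let ?d = "\<lambda>v. a * delta 0 v + c (v - 1)"
  have "fsum ?d = ieval (pCons a f) z"
    using fsum_shift[OF c(1), of 1] c(2) by (simp add: fsum_add fsum_cmult fsum_delta)
  moreover have "periodic (int n) ?d"
    using periodicD[OF periodic_shift[OF c(1), of "-1"]] by (simp add: periodic_def delta_def)
  ultimately show ?case by metis
qed

text \<open>The coefficients of the group ring product of \<open>c\<close> with its reflection
  \<open>v \<mapsto> c (- v)\<close>.\<close>

definition autocorr :: "(int \<Rightarrow> int) \<Rightarrow> int \<Rightarrow> int" where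
  "autocorr c w = (\<Sum>v\<in>I. c (v + w) * c v)"

lemma periodic_autocorr:
  assumes "periodic (int n) c"
  shows "periodic (int n) (autocorr c)"
proof (rule periodicI)
  fix u w :: int
  assume "u mod int n = w mod int n"
  then have "c (v + u) = c (v + w)" for v
    by (intro periodic_cong[OF assms] mod_add_cong refl)
  then show "autocorr c u = autocorr c w" by (simp add: autocorr_def)
qed

lemma fsum_mult_cnj:
  assumes "periodic (int n) c"
  shows "fsum c * cnj (fsum c) = fsum (autocorr c)"
proof -
  have "cnj (fsum c) = (\<Sum>v\<in>I. of_int (c v) * z powi (- v))"
    unfolding fsum_def by (simp add: cnj_z_powi del: complex_cnj_power_int)
  then have "fsum c * cnj (fsum c) = (\<Sum>v\<in>I. of_int (c v) * (z powi (- v) * fsum c))"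
    by (simp add: sum_distrib_left mult_ac)
  also have "\<dots> = (\<Sum>v\<in>I. of_int (c v) * fsum (\<lambda>w. c (w + v)))"
    using fsum_shift[OF assms, of "- v" for v] by simp
  also have "\<dots> = fsum (autocorr c)"
    unfolding fsum_def autocorr_def
    by (simp add: sum_distrib_left sum_distrib_right, subst sum.swap) (simp add: mult_ac add.commute)
  finally show ?thesis .
qed

text \<open>The element \<open>autocorr c - a * delta 0\<close> evaluates to 0, hence is
  \<open>q\<close>-periodic; its values at \<open>q * t\<close> and at 0 agree, and only the latter
  sees \<open>delta 0\<close>.\<close>

lemma autocorr_mult_q:
  assumes "periodic (int n) c" "fsum c * cnj (fsum c) = of_int a" "\<not> int p dvd t"
  shows "autocorr c (int q * t) = autocorr c 0 - a"
proof -
  let ?B = "\<lambda>w. autocorr c w - a * delta 0 w"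
  have "periodic (int n) ?B"
    using periodic_autocorr[OF assms(1)] by (simp add: periodic_def delta_def)
  moreover have "fsum ?B = 0"
    using assms(2) by (simp add: fsum_diff fsum_cmult fsum_delta fsum_mult_cnj[OF assms(1)])
  ultimately have "?B (0 + int q * t) = ?B 0" by (rule q_periodic_if_fsum_eq_0)
  moreover have "\<not> int n dvd int q * t" using assms(3) q_pos by (simp add: n_eq mult.commute)
  ultimately show ?thesis by (simp add: delta_def mod_eq_0_iff_dvd)
qed

text \<open>
  If \<open>u = fsum c\<close> has modulus 1, then \<open>c\<close> and its shifts by \<open>q\<close> and \<open>2 * q\<close> are at squared
  distance 2. The first distance makes the difference \<open>c (v + q) - c v\<close> a rise and a fall by 1,
  the second puts them next to each other, so that \<open>c\<close> is a unit vector up to sign and up to a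
  \<open>q\<close>-periodic function.
\<close>

lemma unimodular_eq_root_of_unity:
  assumes per: "periodic (int n) c" and uni: "fsum c * cnj (fsum c) = 1" and "odd p"
  shows "\<exists>j. fsum c = z powi j \<or> fsum c = - (z powi j)"
proof -
  \<comment> \<open>This makes both shifts, \<open>t = 1\<close> and \<open>t = 2\<close>,
    admissible below.\<close>
  have p3: "p \<ge> 3" using p_gt_1 assms(3) by (cases "p = 2") auto
  have dist: "(\<Sum>v\<in>I. (c (v + int q * t) - c v)\<^sup>2) = 2" if "\<not> int p dvd t" for t
  proof -
    have "(\<Sum>v\<in>I. (c (v + int q * t))\<^sup>2) = (\<Sum>v\<in>I. (c v)\<^sup>2)"
      using per by (intro sum_periodic_shift[where f = "\<lambda>v. (c v)\<^sup>2"] int_n_pos) (simp add: periodic_def)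
    moreover have "autocorr c 0 = (\<Sum>v\<in>I. (c v)\<^sup>2)"
      by (simp add: autocorr_def power2_eq_square)
    ultimately have "(\<Sum>v\<in>I. (c (v + int q * t) - c v)\<^sup>2) = 2 * autocorr c 0 - 2 * autocorr c (int q * t)"
      by (simp add: autocorr_def power2_diff sum.distrib sum_subtractf sum_distrib_left mult.assoc)
    then show ?thesis using autocorr_mult_q[OF per _ that, of 1] uni by simp
  qed
  define d where "d v = c (v + int q) - c v" for v
  have per_d: "periodic (int n) d"
    using periodicD[OF periodic_shift[OF per, of "int q"]] per by (simp add: periodic_def d_def)
  have sum_d: "(\<Sum>v\<in>I. d v) = 0"
    using sum_periodic_shift[OF per int_n_pos, of "int q"] by (simp add: d_def sum_subtractf)
  have sum_d2: "(\<Sum>v\<in>I. (d v)\<^sup>2) = 2" using dist[of 1] p3 by (simp add: d_def)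
  obtain a b where ab: "a \<in> I" "b \<in> I" "a \<noteq> b" "d a = 1" "d b = - 1"
    "\<And>v. v \<in> I \<Longrightarrow> v \<noteq> a \<Longrightarrow> v \<noteq> b \<Longrightarrow> d v = 0"
    using sum_zero_sum_squares_two[OF _ sum_d sum_d2] by auto
  have d_eq: "d v = delta a v - delta b v" for v
  proof -
    have "v mod int n \<in> I" using int_n_pos by simp
    then have "d (v mod int n) = delta a v - delta b v"
      using ab by (cases "v mod int n = a"; cases "v mod int n = b") (auto simp: delta_def)
    then show ?thesis using per_d by (simp add: periodicD)
  qed
  \<comment> \<open>The sum \<open>d (v + q) + d v\<close> telescopes to the shift of
    \<open>c\<close> by \<open>2 * q\<close>, again at squared distance 2. Expanding the square
    forces the cross term to be -1.\<close>
  have "(\<Sum>v\<in>I. (d (v + int q) + d v)\<^sup>2) = 2"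
    using dist[of 2] p3 by (simp add: d_def algebra_simps zdvd_not_zless)
  moreover have "(\<Sum>v\<in>I. (d (v + int q))\<^sup>2) = (\<Sum>v\<in>I. (d v)\<^sup>2)"
    using per_d by (intro sum_periodic_shift[where f = "\<lambda>v. (d v)\<^sup>2"] int_n_pos) (simp add: periodic_def)
  ultimately have "(\<Sum>v\<in>I. d (v + int q) * d v) = -1"
    using sum_d2 by (simp add: power2_sum sum.distrib sum_distrib_left[symmetric] mult.assoc)
  moreover have "(\<Sum>v\<in>I. d (v + int q) * d v) = d (a + int q) - d (b + int q)"
  proof -
    have "(\<Sum>v\<in>I. d (v + int q) * d v) = (\<Sum>v\<in>{a, b}. d (v + int q) * d v)"
      using ab by (intro sum.mono_neutral_right) auto
    then show ?thesis using ab by simp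
  qed
  ultimately have diff: "d (a + int q) - d (b + int q) = -1" by simp
  have neq: "(v + int q) mod int n \<noteq> v mod int n" for v
  proof
    assume "(v + int q) mod int n = v mod int n"
    then have "int n dvd int q" by (simp add: mod_eq_dvd_iff)
    then show False using q_pos q_lt_n by (auto dest: dvd_imp_le)
  qed
  \<comment> \<open>No class is fixed by the shift, so the left side of \<open>diff\<close> is minus
    the number of these two congruences that hold.\<close>
  consider (rise) "(a + int q) mod int n = b mod int n" | (fall) "(b + int q) mod int n = a mod int n"
    using diff neq[of a] neq[of b] unfolding d_eq delta_def by (auto split: if_splits)
  then show ?thesis
  proof cases
    case rise
    define e where "e v = c v - delta b v" for v
    have "delta b (v + int q) = delta a v" for v
      unfolding delta_def rise[symmetric] by (simp add: mod_eq_dvd_iff)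
    then have "e (v + int q) = e v" for v using d_eq[of v] by (simp add: e_def d_def)
    moreover have "periodic (int n) e" using per periodic_delta by (simp add: periodic_def e_def)
    ultimately have "fsum e = 0" by (intro fsum_eq_0)
    then have "fsum c = z powi b" by (simp add: e_def[abs_def] fsum_diff fsum_delta)
    then show ?thesis by blast
  next
    case fall
    define e where "e v = c v + delta a v" for v
    have "delta a (v + int q) = delta b v" for v
      unfolding delta_def fall[symmetric] by (simp add: mod_eq_dvd_iff)
    then have "e (v + int q) = e v" for v using d_eq[of v] by (simp add: e_def d_def)
    moreover have "periodic (int n) e" using per periodic_delta by (simp add: periodic_def e_def)
    ultimately have "fsum e = 0" by (intro fsum_eq_0)
    then have "fsum c = - (z powi a)" by (simp add: e_def[abs_def] fsum_add fsum_delta eq_neg_iff_add_eq_0)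
    then show ?thesis by blast
  qed
qed

end

section \<open>The quotient of a group ring element by its conjugate\<close>

context prime_power_root
begin

text \<open>The conjugate of \<open>z\<close> is \<open>z ^ (n - 1)\<close>, so
  \<open>\<int>[z]\<close> is closed under conjugation.\<close>

lemma cnj_ieval_z: "cnj (ieval f z) = ieval (pcompose f (monom 1 (n - 1))) z"
proof -
  have "z * z ^ (n - 1) = 1" using z_power_n n_pos by (simp flip: power_Suc)
  then have "cnj z = z ^ (n - 1)" unfolding cnj_z by (rule inverse_unique)
  then show ?thesis by (simp add: ieval_pcompose cnj_ieval)
qed

text \<open>Expanding at 1, \<open>f(z)\<close> and \<open>f(1)\<close> agree modulo
  \<open>1 - z\<close>; the same expansion of \<open>cyclo\<close> shows that \<open>p\<close> is a
  multiple of \<open>1 - z\<close>.\<close>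

lemma one_minus_root_dvd_ieval:
  assumes "int p dvd poly f 1"
  shows "\<exists>g. ieval f z = (1 - z) * ieval g z"
proof -
  have taylor: "\<exists>h'. ieval h z = of_int (poly h 1) + (1 - z) * ieval h' z" for h
  proof -
    have "[:-1, 1:] dvd h - [:poly h 1:]" by (simp add: poly_eq_0_iff_dvd[symmetric])
    then obtain h' where h': "h - [:poly h 1:] = [:-1, 1:] * h'" by blast
    have "ieval h z = of_int (poly h 1) + ieval (h - [:poly h 1:]) z" by simp
    also have "ieval (h - [:poly h 1:]) z = (z - 1) * ieval h' z"
      unfolding h' ieval_mult by simp
    finally show ?thesis by (intro exI[of _ "- h'"]) (simp add: ieval_minus algebra_simps)
  qed
  obtain c where c: "poly f 1 = int p * c" using assms by blast
  obtain h where h: "ieval cyclo z = of_int (poly cyclo 1) + (1 - z) * ieval h z"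
    using taylor by blast
  then have "(of_nat p :: complex) = - ((1 - z) * ieval h z)"
    by (simp add: ieval_cyclo poly_cyclo_1 add_eq_0_iff)
  then have p: "of_int (poly f 1) = (1 - z) * ieval (smult (- c) h) z"
    by (simp add: c)
  obtain f' where "ieval f z = of_int (poly f 1) + (1 - z) * ieval f' z" using taylor by blast
  then have "ieval f z = (1 - z) * ieval (smult (- c) h + f') z"
    unfolding p by (simp add: algebra_simps)
  then show ?thesis by blast
qed

text \<open>By the Frobenius congruence \<open>(1 - x) ^ n \<equiv> 1 - x ^ n\<close> modulo
  \<open>p\<close>, and the right side vanishes at \<open>z\<close>.\<close>

lemma prime_dvd_one_minus_root_power: "\<exists>g. (1 - z) ^ n = of_nat p * ieval g z"
proof -
  obtain g where g: "[:1, -1 :: int:] ^ n - pcompose [:1, -1:] (monom 1 n) = of_nat p * g"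
    using prime_dvd_poly_prime_power_diff_pcompose[OF prime_p, of "[:1, -1:]" "Suc m", folded n_def] by blast
  have "ieval ([:1, -1:] ^ n - pcompose [:1, -1:] (monom 1 n)) z = (1 - z) ^ n"
    by (simp add: ieval_pcompose z_power_n)
  then have "(1 - z) ^ n = of_nat p * ieval g z" unfolding g by simp
  then show ?thesis ..
qed

lemma prime_not_unit: "of_nat p * ieval g z \<noteq> 1"
proof
  assume "of_nat p * ieval g z = 1"
  then have "ieval (of_nat p * g - 1) z = 0" by simp
  then have "int p dvd int p * poly g 1 - 1"
    using prime_dvd_poly_1_of_ieval_eq_0 by fastforce
  then have "int p dvd 1" by (simp add: dvd_diff_right_iff)
  then show False using p_gt_1 by simp
qed

text \<open>
  The prime \<open>1 - z\<close> is associated to its conjugate and is the only prime dividing \<open>p\<close>. Hence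
  \<open>ieval f z\<close> is a power of \<open>1 - z\<close> times a unit.
\<close>

lemma quotient_cnj_integral:
  assumes norm: "ieval f z * cnj (ieval f z) = of_nat (p ^ a)"
  shows "\<exists>g. ieval f z = ieval g z * cnj (ieval f z)"
proof -
  \<comment> \<open>Factors \<open>1 - z\<close> are split off. If this never stopped,
    \<open>p ^ Suc a\<close> would divide \<open>ieval f z\<close>, and comparison with the norm
    \<open>p ^ a\<close> would make \<open>p\<close> a unit.\<close>
  have "\<exists>e g. ieval f z = (1 - z) ^ e * ieval g z \<and> \<not> int p dvd poly g 1"
  proof (rule ccontr)
    assume no: "\<not> ?thesis"
    have all: "\<exists>g. ieval f z = (1 - z) ^ e * ieval g z" for e
    proof (induction e)
      case (Suc e)
      then obtain g where g: "ieval f z = (1 - z) ^ e * ieval g z" by blast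
      then have "int p dvd poly g 1" using no by blast
      then obtain h where "ieval g z = (1 - z) * ieval h z" using one_minus_root_dvd_ieval by blast
      then show ?case using g by (auto simp: mult_ac)
    qed auto
    obtain g where g: "ieval f z = (1 - z) ^ (n * Suc a) * ieval g z" using all by blast
    obtain r where r: "(1 - z) ^ n = of_nat p * ieval r z"
      using prime_dvd_one_minus_root_power by blast
    define h where "h = r ^ Suc a * g"
    have f_eq: "ieval f z = of_nat p ^ Suc a * ieval h z"
      using g by (simp only: power_mult r power_mult_distrib ieval_mult ieval_power mult.assoc h_def)
    have "of_nat p ^ a = of_nat p ^ Suc a * of_nat p ^ Suc a * (ieval h z * cnj (ieval h z))"
      using norm by (subst (asm) f_eq, subst (asm) f_eq) (simp add: mult_ac)
    also have "\<dots> = of_nat p ^ a * (of_nat p * ieval (of_nat p ^ Suc a *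
        (h * pcompose h (monom 1 (n - 1)))) z)"
      by (simp only: cnj_ieval_z ieval_mult ieval_power ieval_of_nat power_Suc mult_ac)
    finally have "of_nat p * ieval (of_nat p ^ Suc a * (h * pcompose h (monom 1 (n - 1)))) z = 1"
      using p_gt_1 by (metis mult_cancel_left1 of_nat_eq_0_iff power_not_zero not_one_less_zero)
    then show False using prime_not_unit by blast
  qed
  then obtain e g where g: "ieval f z = (1 - z) ^ e * ieval g z" "\<not> int p dvd poly g 1" by blast
  define N where "N = g * pcompose g (monom 1 (n - 1))"
  have N: "ieval N z = ieval g z * cnj (ieval g z)" by (simp add: N_def cnj_ieval_z)
  \<comment> \<open>The substitution that represents conjugation fixes the point 1.\<close>
  have N1: "poly N 1 = (poly g 1)\<^sup>2" by (simp add: N_def poly_pcompose poly_monom power2_eq_square)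
  have "coprime (poly N 1) (int p)"
    using g(2) prime_p by (simp add: N1 coprime_commute prime_imp_coprime)
  \<comment> \<open>The Bezout relation makes \<open>k = 1 - b * N\<close> a multiple of
    \<open>1 - z\<close> at the root.\<close>
  then obtain b d where bd: "b * poly N 1 + d * int p = 1"
    using bezout_int[of "poly N 1" "int p"] by auto
  define k where "k = 1 - smult b N"
  have "poly k 1 = int p * d" using bd by (simp add: k_def mult.commute)
  then obtain k' where k': "ieval k z = (1 - z) * ieval k' z"
    using one_minus_root_dvd_ieval[of k] by auto
  obtain r where r: "(1 - z) ^ n = of_nat p * ieval r z"
    using prime_dvd_one_minus_root_power by blast
  \<comment> \<open>\<open>N\<close> divides the norm \<open>p ^ a\<close>, which divides this power
    of \<open>1 - z\<close>.\<close>
  have "(1 - z) ^ (n * a) = of_nat (p ^ a) * ieval (r ^ a) z"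
    by (simp add: power_mult r power_mult_distrib)
  also have "of_nat (p ^ a) = ieval N z * ieval (([:1, -1:] * pcompose [:1, -1:] (monom 1 (n - 1))) ^ e) z"
    by (simp only: norm[symmetric] N ieval_mult ieval_power cnj_ieval_z[symmetric])
       (simp add: g(1) power_mult_distrib mult_ac)
  finally have "(1 - z) ^ (n * a) = ieval N z *
     ieval (([:1, -1:] * pcompose [:1, -1:] (monom 1 (n - 1))) ^ e * r ^ a) z"
    by simp
  then obtain s where s: "(1 - z) ^ (n * a) = ieval N z * ieval s z" by blast
  \<comment> \<open>\<open>k ^ (n * a)\<close> is 1 modulo \<open>N\<close> and, at the root, a
    multiple of \<open>(1 - z) ^ (n * a)\<close>, hence of \<open>N\<close>. So \<open>N\<close>
    becomes a unit at the root, with inverse \<open>w\<close>.\<close>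
  have "N dvd 1 ^ (n * a) - k ^ (n * a)"
    by (rule dvd_power_diff) (simp add: k_def dvd_smult)
  then obtain t where "1 - k ^ (n * a) = N * t" by auto
  then have "ieval k z ^ (n * a) + ieval N z * ieval t z = 1"
    by (metis diff_add_cancel add.commute ieval_1 ieval_add ieval_mult ieval_power)
  then have "ieval N z * ieval (s * k' ^ (n * a) + t) z = 1"
    by (simp only: k' power_mult_distrib s ieval_add ieval_mult ieval_power distrib_left mult.assoc)
  then obtain w where w: "ieval N z * ieval w z = 1" by blast
  have "1 - z = - z * cnj (1 - z)" using z_nz by (simp add: cnj_z right_diff_distrib)
  then have e: "(1 - z) ^ e = (- z) ^ e * cnj (1 - z) ^ e" by (metis power_mult_distrib)
  \<comment> \<open>The quotient of \<open>g\<close> by its conjugate is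
    \<open>g\<^sup>2 / N = g\<^sup>2 * w\<close>; the factors \<open>1 - z\<close> contribute
    \<open>(- z) ^ e\<close>.\<close>
  have "ieval ([:0, -1:] ^ e * g * g * w) z * cnj (ieval f z) =
      ((- z) ^ e * cnj (1 - z) ^ e) * ieval g z * (ieval N z * ieval w z)"
    by (simp add: N g(1) mult_ac)
  also have "\<dots> = ieval f z" by (simp only: w e[symmetric] g(1) mult_1_right)
  finally show ?thesis by metis
qed

text \<open>The quotient by the conjugate lies in \<open>\<int>[z]\<close> and has modulus 1, so it
  is a power of \<open>z\<close> up to sign.\<close>

lemma fsum_eq_root_of_unity_mult_cnj:
  assumes "odd p" and norm: "fsum c * cnj (fsum c) = of_nat (p ^ a)"
  shows "\<exists>j. fsum c = z powi j * cnj (fsum c) \<or> fsum c = - (z powi j * cnj (fsum c))"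
proof -
  have "\<exists>f. fsum c = ieval f z"
  proof
    show "fsum c = ieval (\<Sum>i<n. monom (c (int i)) i) z"
      unfolding fsum_def ieval_sum by (rule sum.reindex_bij_witness[of _ int nat]) (auto simp: power_int_def)
  qed
  then obtain g where g: "fsum c = ieval g z * cnj (fsum c)"
    using quotient_cnj_integral norm by metis
  obtain d where d: "periodic (int n) d" "ieval g z = fsum d" using ieval_eq_fsum by blast
  have nz: "fsum c \<noteq> 0" using norm p_gt_1 by auto
  have "norm (fsum c) = norm (fsum d) * norm (fsum c)"
    using arg_cong[OF g, of norm] d by (simp add: norm_mult)
  then have "norm (fsum d) = 1" using nz by simp
  then have "fsum d * cnj (fsum d) = 1" by (simp add: complex_norm_square[symmetric])
  then obtain j where "fsum d = z powi j \<or> fsum d = - (z powi j)"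
    using unimodular_eq_root_of_unity[OF d(1) _ assms(1)] by blast
  then show ?thesis using g d(2) by (metis mult_minus_left)
qed

section \<open>The symmetry of a set whose character sum has norm \<open>card S\<close>\<close>

definition ind :: "int set \<Rightarrow> int \<Rightarrow> int" where
  "ind S v = (if v mod int n \<in> S then 1 else 0)"

lemma periodic_ind: "periodic (int n) (ind S)"
  by (simp add: periodic_def ind_def)

lemma ind_cases: "ind S v = 0 \<or> ind S v = 1"
  by (simp add: ind_def)

lemma cnj_fsum: 
  assumes "periodic (int n) c"
  shows "z powi j * cnj (fsum c) = fsum (\<lambda>v. c (j - v))"
proof -
  have "z powi j * cnj (fsum c) = (\<Sum>v\<in>I. of_int (c v) * z powi (j - v))"
    unfolding fsum_def diff_conv_add_uminus z_powi_add
    by (simp add: cnj_z_powi sum_distrib_left mult_ac del: complex_cnj_power_int)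
  also have "\<dots> = (\<Sum>v\<in>I. of_int (c (j - (j - v))) * z powi (j - v))" by simp
  also have "\<dots> = fsum (\<lambda>v. c (j - v))"
    unfolding fsum_def
  proof (rule sum_periodic_reflect[OF _ int_n_pos])
    show "periodic (int n) (\<lambda>v. of_int (c (j - v)) * z powi v :: complex)"
    proof (rule periodicI)
      fix u v :: int
      assume eq: "u mod int n = v mod int n"
      then have "c (j - u) = c (j - v)"
        by (intro periodic_cong[OF assms] mod_diff_cong refl)
      then show "of_int (c (j - u)) * z powi u = (of_int (c (j - v)) * z powi v :: complex)"
        using z_powi_cong[OF eq] by simp
    qed
  qed
  finally show ?thesis .
qed

text \<open>
  The multiplier \<open>\<plusminus>z\<^sup>j\<close> turns \<open>S\<close> into \<open>j - S\<close>, so \<open>(s, t)\<close> and \<open>(j - t, j - s)\<close> have the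
  same difference.
\<close>

lemma no_flat_set_with_distinct_differences:
  assumes "odd p" and S: "S \<subseteq> I" and card: "card S = p ^ a"
    and norm: "fsum (ind S) * cnj (fsum (ind S)) = of_nat (card S)"
    and st: "s \<in> S" "t \<in> S" "\<not> int p dvd s - t"
    and unique: "\<And>y. \<not> int p dvd y \<Longrightarrow> autocorr (ind S) y \<le> 1"
  shows False
proof -
  have p3: "p \<ge> 3" using p_gt_1 assms(1) by (cases "p = 2") auto
  have fin: "finite S" using S finite_subset by blast
  have mod_S: "v mod int n = v" if "v \<in> S" for v using S that by auto
  have ind_S: "ind S v = 1" if "v \<in> S" for v using mod_S[OF that] that by (simp add: ind_def)
  have "autocorr (ind S) 0 = (\<Sum>v\<in>I. if v \<in> S then 1 else 0)"
    unfolding autocorr_def by (rule sum.cong) (auto simp: ind_def)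
  also have "\<dots> = int (card S)" using S by (simp add: sum.If_cases Int_absorb1)
  \<comment> \<open>The norm equals the autocorrelation at 0, so no two elements of \<open>S\<close>
    differ by \<open>q * t\<close> with \<open>t\<close> prime to \<open>p\<close>.\<close>
  finally have "autocorr (ind S) (int q * t) = 0" if "\<not> int p dvd t" for t
    using autocorr_mult_q[OF periodic_ind _ that, of S "int (card S)"] norm by simp
  moreover have "ind S (v + int q * t) * ind S v \<le> autocorr (ind S) (int q * t)" for v t
  proof -
    have "ind S (v mod int n + int q * t) * ind S (v mod int n) \<le> autocorr (ind S) (int q * t)"
      unfolding autocorr_def using int_n_pos by (intro member_le_sum) (auto simp: ind_def)
    then show ?thesis by (simp add: ind_def mod_simps)
  qed
  ultimately have disj: "ind S (v + int q * t) = 0 \<or> ind S v = 0" if "\<not> int p dvd t" for v t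
    using ind_cases[of S v] ind_cases[of S "v + int q * t"] that
    by (metis mult_1 not_one_le_zero)
  have p12: "\<not> int p dvd 1" "\<not> int p dvd 2" using p3 by (auto dest: zdvd_imp_le)
  have per_refl: "periodic (int n) (\<lambda>v. ind S (j - v))" for j
    by (simp add: periodic_def ind_def mod_simps)
  obtain j where "fsum (ind S) = z powi j * cnj (fsum (ind S)) \<or>
      fsum (ind S) = - (z powi j * cnj (fsum (ind S)))"
    using fsum_eq_root_of_unity_mult_cnj[OF assms(1)] norm card by metis
  then have j: "fsum (ind S) = fsum (\<lambda>v. ind S (j - v)) \<or> fsum (ind S) = - fsum (\<lambda>v. ind S (j - v))"
    by (simp only: cnj_fsum[OF periodic_ind])
  have sym: "ind S (j - r) = 1" if r: "r \<in> S" for r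
    using j
  proof
    assume *: "fsum (ind S) = fsum (\<lambda>v. ind S (j - v))"
    \<comment> \<open>At \<open>r\<close> the first term is 1 and at \<open>r + q\<close> it is 0,
      so periodicity forces \<open>ind S (j - r)\<close> to be 1.\<close>
    let ?c = "\<lambda>v. ind S v - ind S (j - v)"
    have "periodic (int n) ?c" using periodic_ind per_refl[of j] by (simp add: periodic_def)
    moreover have "fsum ?c = 0" using * by (simp add: fsum_diff)
    ultimately have "?c (r + int q * 1) = ?c r" by (rule q_periodic_if_fsum_eq_0)
    then show ?thesis
      using disj[OF p12(1), of r] ind_S[OF r] ind_cases[of S "j - r"] ind_cases[of S "j - (r + int q)"]
      by auto
  next
    assume *: "fsum (ind S) = - fsum (\<lambda>v. ind S (j - v))"
    \<comment> \<open>This sign is impossible: periodicity would put both \<open>j - r - q\<close>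
      and \<open>j - r - 2 * q\<close> into \<open>S\<close> modulo \<open>n\<close>, against
      \<open>disj\<close>.\<close>
    let ?c = "\<lambda>v. ind S v + ind S (j - v)"
    have "periodic (int n) ?c" using periodic_ind per_refl[of j] by (simp add: periodic_def)
    moreover have "fsum ?c = 0" using * by (simp add: fsum_add)
    ultimately have "?c (r + int q * t) = ?c r" for t by (rule q_periodic_if_fsum_eq_0)
    from this[of 1] this[of 2] show ?thesis
      using disj[OF p12(1), of r] disj[OF p12(2), of r] disj[OF p12(1), of "j - (r + int q * 2)"]
        ind_S[OF r] ind_cases[of S "j - r"] by (auto simp: algebra_simps)
  qed
  have refl: "y = (j - x) mod int n" if xy: "x \<in> S" "y \<in> S" "\<not> int p dvd x - y" for x y
  proof (rule ccontr)
    assume neq: "y \<noteq> (j - x) mod int n"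
    let ?f = "\<lambda>v. ind S (v + (x - y)) * ind S v"
    have f1: "?f y = 1" "?f ((j - x) mod int n) = 1"
      using xy ind_S sym[OF xy(1)] sym[OF xy(2)] by (simp_all add: ind_def mod_simps)
    have "(\<Sum>v\<in>{y, (j - x) mod int n}. ?f v) \<le> (\<Sum>v\<in>I. ?f v)"
      using xy S int_n_pos by (intro sum_mono2) (auto simp: ind_def)
    then have "2 \<le> autocorr (ind S) (x - y)"
      using f1 neq by (simp add: autocorr_def)
    then show False using unique[OF xy(3)] by simp
  qed
  have "S = {s, t}"
  proof (intro equalityI subsetI)
    fix r assume r: "r \<in> S"
    \<comment> \<open>Every \<open>r\<close> has a unit difference with \<open>s\<close> or with
      \<open>t\<close>; reflection then identifies it with \<open>t\<close> or \<open>s\<close>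
      respectively.\<close>
    have "\<not> int p dvd s - r \<or> \<not> int p dvd t - r"
      using st(3) dvd_diff[of "int p" "s - r" "t - r"] by auto
    then show "r \<in> {s, t}"
    proof
      assume "\<not> int p dvd s - r"
      then show ?thesis using refl[OF st(1) r] refl[OF st] by simp
    next
      assume "\<not> int p dvd t - r"
      moreover have "\<not> int p dvd t - s" using st(3) by (simp add: dvd_diff_commute)
      ultimately show ?thesis using refl[OF st(2) r] refl[OF st(2,1)] by simp
    qed
  qed (use st in auto)
  moreover have "s \<noteq> t" using st(3) by auto
  ultimately have "card S = 2" by simp
  then have "even (p ^ a)" using card by simp
  then show False using assms(1) by simp
qed

end

section \<open>Formal duality\<close>

lemma zeta_powi_eq_1_iff:
  assumes "n > 0"
  shows "zeta n powi y = 1 \<longleftrightarrow> int n dvd y"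
proof -
  have zeta: "zeta n = cis (2 * pi / real n)"
    by (simp add: zeta_def cis_conv_exp mult_ac)
  have powi: "zeta n powi y = cis (real_of_int y * (2 * pi / real n))"
    unfolding zeta by (simp add: cis_power_int)
  show ?thesis
  proof
    assume "zeta n powi y = 1"
    then have "cos (real_of_int y * (2 * pi / real n)) = 1"
      unfolding powi by (metis cis.sel(1) one_complex.sel(1))
    then obtain k :: int where "real_of_int y * (2 * pi / real n) = real_of_int k * 2 * pi"
      using cos_one_2pi_int by metis
    then have "real_of_int y = real_of_int (k * int n)" using assms by (simp add: field_simps)
    then have "y = k * int n" by (simp only: of_int_eq_iff)
    then show "int n dvd y" by simp
  next
    assume "int n dvd y"
    then obtain k where "y = int n * k" by blast
    then have "real_of_int y * (2 * pi / real n) = 2 * pi * of_int k" using assms by simp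
    then show "zeta n powi y = 1" unfolding powi by (simp only: cis_multiple_2pi Ints_of_int)
  qed
qed

lemma zeta_nz: "zeta n \<noteq> 0"
  by (simp add: zeta_def)

text \<open>Orthogonality of characters: shifting \<open>y\<close> by 1 multiplies the sum by
  \<open>zeta n powi w\<close>.\<close>

lemma sum_zeta_powi:
  assumes "n > 0"
  shows "(\<Sum>y\<in>{0..<int n}. zeta n powi (w * y)) = (if int n dvd w then of_nat n else 0)"
proof (cases "int n dvd w")
  case True
  then have "zeta n powi (w * y) = 1" for y using zeta_powi_eq_1_iff[OF assms] by simp
  then show ?thesis using True by simp
next
  case False
  let ?f = "\<lambda>y. zeta n powi (w * y)"
  have add: "?f (u + v) = ?f u * ?f v" for u v
    by (simp add: distrib_left power_int_add zeta_nz)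
  have "periodic (int n) ?f"
  proof (rule periodicI)
    fix u v assume "u mod int n = v mod int n"
    then have "int n dvd w * (u - v)" by (simp add: mod_eq_dvd_iff)
    then have "?f (u - v) = 1" using zeta_powi_eq_1_iff[OF assms] by simp
    then show "?f u = ?f v" using add[of "u - v" v] by simp
  qed
  then have "(\<Sum>y\<in>{0..<int n}. ?f (y + 1)) = (\<Sum>y\<in>{0..<int n}. ?f y)"
    using assms by (intro sum_periodic_shift) auto
  then have "(\<Sum>y\<in>{0..<int n}. ?f y) * ?f 1 = (\<Sum>y\<in>{0..<int n}. ?f y)"
    by (simp only: add sum_distrib_right)
  moreover have "?f 1 \<noteq> 1" using False zeta_powi_eq_1_iff[OF assms] by simp
  ultimately show ?thesis using False by simp
qed

section \<open>Weight enumerators and Fourier inversion\<close>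

lemma weight_enumerator_eq_card:
  assumes "n > 0" "S \<subseteq> {0..<int n}"
  shows "weight_enumerator n S y = card {x \<in> S \<times> S. (fst x - snd x) mod int n = y}"
proof -
  have "v \<otimes>\<^bsub>integer_mod_group n\<^esub> inv\<^bsub>integer_mod_group n\<^esub> w = (v - w) mod int n"
    if "w \<in> S" for v w
    using assms that by (subst inv_integer_mod_group)
      (auto simp: carrier_integer_mod_group mod_simps)
  then have "{(v, w). v \<in> S \<and> w \<in> S \<and>
       v \<otimes>\<^bsub>integer_mod_group n\<^esub> inv\<^bsub>integer_mod_group n\<^esub> w = y} =
     {x \<in> S \<times> S. (fst x - snd x) mod int n = y}" by auto
  then show ?thesis by (simp only: weight_enumerator_def)
qed

lemma weight_enumerator_0:
  assumes "n > 0" "S \<subseteq> {0..<int n}"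
  shows "weight_enumerator n S 0 = card S"
proof -
  have diag: "v = w" if "v \<in> S" "w \<in> S" "int n dvd v - w" for v w
  proof -
    have "v mod int n = w mod int n" using that(3) by (simp add: mod_eq_dvd_iff)
    moreover have "v mod int n = v" "w mod int n = w" using that assms by auto
    ultimately show ?thesis by simp
  qed
  have "{x \<in> S \<times> S. (fst x - snd x) mod int n = 0} = (\<lambda>v. (v, v)) ` S"
    by (auto simp: mod_eq_0_iff_dvd dest: diag)
  then show ?thesis
    by (simp add: weight_enumerator_eq_card[OF assms] card_image inj_on_def)
qed

lemma weight_enumerator_uminus:
  assumes "n > 0" "S \<subseteq> {0..<int n}" "y \<in> {0..<int n}"
  shows "weight_enumerator n S ((- y) mod int n) = weight_enumerator n S y"
proof -
  have "(v - w) mod int n = (- y) mod int n \<longleftrightarrow> (w - v) mod int n = y" for v w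
  proof -
    have "(w - v) mod int n = y \<longleftrightarrow> (w - v) mod int n = y mod int n" using assms by simp
    then show ?thesis by (simp add: mod_eq_dvd_iff) (metis dvd_minus_iff minus_diff_eq diff_diff_eq2 add.commute diff_minus_eq_add)
  qed
  then have "bij_betw prod.swap {x \<in> S \<times> S. (fst x - snd x) mod int n = (- y) mod int n}
      {x \<in> S \<times> S. (fst x - snd x) mod int n = y}"
    by (intro bij_betw_byWitness[where f' = prod.swap]) auto
  then show ?thesis
    unfolding weight_enumerator_eq_card[OF assms(1,2)] by (rule bij_betw_same_card)
qed

lemma sum_weight_enumerator:
  assumes "n > 0" "S \<subseteq> {0..<int n}"
  shows "(\<Sum>y\<in>{0..<int n}. weight_enumerator n S y) = (card S)\<^sup>2"
proof -
  have fin: "finite (S \<times> S)" using finite_subset[OF assms(2)] by simp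
  have "(\<Sum>y\<in>{0..<int n}. weight_enumerator n S y) =
     (\<Sum>y\<in>{0..<int n}. \<Sum>x\<in>{x \<in> S \<times> S. (fst x - snd x) mod int n = y}. 1)"
    by (simp add: weight_enumerator_eq_card[OF assms])
  also have "\<dots> = (\<Sum>x\<in>S \<times> S. 1)"
    using fin assms(1) by (intro sum.group) auto
  finally show ?thesis by (simp add: card_cartesian_product power2_eq_square)
qed

lemma formally_dualD:
  assumes "n > 0" "formally_dual n S T"
  shows "S \<noteq> {}" "T \<noteq> {}" "S \<subseteq> {0..<int n}" "T \<subseteq> {0..<int n}"
    "y \<in> {0..<int n} \<Longrightarrow> of_nat (card S) ^ 2 / of_nat (card T) * of_nat (weight_enumerator n T y) =
        (\<Sum>v\<in>{0..<int n}. of_nat (weight_enumerator n S v) * zeta n powi (v * y))"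
  using assms unfolding formally_dual_def carrier_integer_mod_group by auto

text \<open>The duality relation is transformed once more. Inversion at 0 gives
  \<open>card S * card T = n\<close>; inserting this at a general \<open>w\<close> gives the
  relation with \<open>S\<close> and \<open>T\<close> exchanged.\<close>

lemma
  assumes n: "n > 0" and dual: "formally_dual n S T"
  shows formally_dual_card: "card S * card T = n"
    and formally_dual_commute: "formally_dual n T S"
proof -
  let ?I = "{0..<int n}" and ?\<nu> = "weight_enumerator n"
  note D = formally_dualD[OF n dual]
  have pos: "card S > 0" "card T > 0"
    using D finite_subset[of _ ?I] by (simp_all add: card_gt_0_iff)
  define h :: complex where "h = of_nat (card S) ^ 2 / of_nat (card T)"
  define F where "F w = (\<Sum>y\<in>?I. of_nat (?\<nu> T y) * zeta n powi (y * w))" for w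
  have inversion: "h * F w = of_nat n * of_nat (?\<nu> S w)" if w: "w \<in> ?I" for w
  proof -
    have "h * F w = (\<Sum>y\<in>?I. h * of_nat (?\<nu> T y) * zeta n powi (y * w))"
      by (simp add: F_def sum_distrib_left mult.assoc)
    also have "\<dots> = (\<Sum>y\<in>?I. (\<Sum>v\<in>?I. of_nat (?\<nu> S v) * zeta n powi (v * y)) * zeta n powi (y * w))"
      by (rule sum.cong) (simp_all only: h_def D(5))
    also have "\<dots> = (\<Sum>v\<in>?I. of_nat (?\<nu> S v) * (\<Sum>y\<in>?I. zeta n powi ((v + w) * y)))"
    proof -
      have "zeta n powi (v * y) * zeta n powi (y * w) = zeta n powi ((v + w) * y)" for v y
        by (simp add: distrib_right power_int_add zeta_nz mult.commute[of w])
      then show ?thesis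
        by (simp only: sum_distrib_right sum_distrib_left mult.assoc, subst sum.swap) (rule refl)
    qed
    \<comment> \<open>By orthogonality only the class of \<open>- w\<close> remains; the weight
      enumerator is even, so it may be replaced by \<open>w\<close>.\<close>
    also have "\<dots> = (\<Sum>v\<in>?I. if v = (- w) mod int n then of_nat n * of_nat (?\<nu> S v) else 0)"
    proof (rule sum.cong)
      fix v assume v: "v \<in> ?I"
      then have "v = (- w) mod int n \<longleftrightarrow> v mod int n = (- w) mod int n" by simp
      then have "int n dvd v + w \<longleftrightarrow> v = (- w) mod int n" by (simp add: mod_eq_dvd_iff)
      then show "of_nat (?\<nu> S v) * (\<Sum>y\<in>?I. zeta n powi ((v + w) * y)) =
        (if v = (- w) mod int n then of_nat n * of_nat (?\<nu> S v) else 0)"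
        by (simp add: sum_zeta_powi[OF n])
    qed simp
    also have "\<dots> = of_nat n * of_nat (?\<nu> S ((- w) mod int n))" using n by simp
    finally show ?thesis by (simp add: weight_enumerator_uminus[OF n D(3) w])
  qed
  have "F 0 = of_nat (card T) ^ 2"
    using arg_cong[OF sum_weight_enumerator[OF n D(4)], of "of_nat :: nat \<Rightarrow> complex"]
    by (simp add: F_def)
  then have "(of_nat (card S) ^ 2 * of_nat (card T) :: complex) = of_nat n * of_nat (card S)"
    using inversion[of 0] n pos weight_enumerator_0[OF n D(3)]
    by (simp add: h_def field_simps power2_eq_square)
  then have "of_nat (card S ^ 2 * card T) = (of_nat (n * card S) :: complex)" by simp
  then have "card S ^ 2 * card T = n * card S" by (simp only: of_nat_eq_iff)
  then show card: "card S * card T = n" using pos by (simp add: power2_eq_square)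
  have "of_nat (card T) ^ 2 / of_nat (card S) * of_nat (?\<nu> S w) = F w" if "w \<in> ?I" for w
  proof -
    have "of_nat (card S) ^ 2 / of_nat (card T) * F w =
       (of_nat (card S) * of_nat (card T)) * of_nat (?\<nu> S w)"
      using inversion[OF that] by (simp add: h_def card[symmetric])
    then show ?thesis using pos by (simp add: field_simps power2_eq_square)
  qed
  then show "formally_dual n T S"
    unfolding formally_dual_def carrier_integer_mod_group using D n by (simp add: F_def)
qed

section \<open>Consequences of primitivity in the prime power case\<close>

text \<open>Otherwise \<open>S\<close> would lie in one coset of the proper subgroup of multiples of
  \<open>p\<close>.\<close>

lemma unit_difference_if_not_in_proper_coset:
  assumes "prime p" "\<not> in_proper_coset (p ^ Suc m) S" "S \<noteq> {}" "S \<subseteq> {0..<int (p ^ Suc m)}"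
  shows "\<exists>s\<in>S. \<exists>t\<in>S. \<not> int p dvd s - t"
proof (rule ccontr)
  assume "\<not> ?thesis"
  then have all: "int p dvd s - t" if "s \<in> S" "t \<in> S" for s t using that by blast
  define N where "N = p ^ Suc m"
  have p1: "p > 1" using assms(1) prime_gt_1_nat by blast
  have N: "N > 1" "p dvd N" using p1 one_less_power[of p "Suc m"] by (simp_all add: N_def)
  have pN: "int p dvd int N" using N(2) by simp
  define G where "G = integer_mod_group N"
  interpret group G by (simp add: G_def)
  have carrier: "carrier G = {0..<int N}" using N by (simp add: G_def carrier_integer_mod_group)
  define H where "H = {x \<in> carrier G. int p dvd x}"
  have "subgroup H G"
  proof (rule subgroupI)
    show "H \<noteq> {}" using N by (auto simp: H_def carrier intro!: exI[of _ 0])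
    show "inv\<^bsub>G\<^esub> a \<in> H" if "a \<in> H" for a
    proof -
      have "inv\<^bsub>G\<^esub> a = (- a) mod int N"
        unfolding G_def using that by (intro inv_integer_mod_group) (simp add: H_def G_def)
      then show ?thesis using that N pN by (auto simp: H_def carrier dvd_mod_iff)
    qed
    show "a \<otimes>\<^bsub>G\<^esub> b \<in> H" if "a \<in> H" "b \<in> H" for a b
    proof -
      have "a \<otimes>\<^bsub>G\<^esub> b = (a + b) mod int N" by (simp add: G_def)
      then show ?thesis using that N pN by (auto simp: H_def carrier dvd_mod_iff)
    qed
  qed (auto simp: H_def)
  moreover have "H \<noteq> carrier G"
  proof
    assume "H = carrier G"
    moreover have "1 \<in> carrier G" using N by (simp add: carrier)
    ultimately have "int p dvd 1" unfolding H_def by blast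
    then show False using p1 by simp
  qed
  moreover obtain t where t: "t \<in> S" using assms(3) by blast
  have SG: "S \<subseteq> carrier G" using assms(4) by (simp add: carrier N_def)
  have "H #>\<^bsub>G\<^esub> t \<in> rcosets\<^bsub>G\<^esub> H" using t SG by (auto simp: RCOSETS_def)
  moreover have "S \<subseteq> H #>\<^bsub>G\<^esub> t"
  proof
    fix s assume s: "s \<in> S"
    have "(s - t) mod int N \<in> H"
      using all[OF s t] N pN by (auto simp: H_def carrier dvd_mod_iff)
    moreover have "s = (s - t) mod int N \<otimes>\<^bsub>G\<^esub> t"
    proof -
      have "s mod int N = s" using s SG by (auto simp: carrier)
      then show ?thesis by (simp add: G_def mod_simps)
    qed
    ultimately show "s \<in> H #>\<^bsub>G\<^esub> t" unfolding r_coset_def by blast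
  qed
  ultimately have "in_proper_coset N S" unfolding in_proper_coset_def G_def by blast
  then show False using assms(2) by (simp add: N_def)
qed

lemma prime_power_root_zeta:
  assumes "prime p" "\<not> int p dvd y"
  shows "prime_power_root p m (zeta (p ^ Suc m) powi y)"
proof
  have pos: "p ^ Suc m > 0" using prime_gt_0_nat[OF assms(1)] by simp
  have pow: "(zeta (p ^ Suc m) powi y) ^ i = 1 \<longleftrightarrow> int (p ^ Suc m) dvd y * int i" for i
    unfolding zeta_powi_eq_1_iff[OF pos, symmetric] by (simp only: power_int_mult power_int_of_nat)
  show "(zeta (p ^ Suc m) powi y) ^ (p ^ Suc m) = 1" unfolding pow by simp
  show "(zeta (p ^ Suc m) powi y) ^ (p ^ m) \<noteq> 1"
  proof -
    have "int (p ^ m) \<noteq> 0" using prime_gt_0_nat[OF assms(1)] by simp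
    moreover have "int (p ^ Suc m) = int p * int (p ^ m)" by simp
    ultimately show ?thesis unfolding pow using assms(2) by (metis dvd_mult_cancel_right)
  qed
qed (rule assms(1))

context prime_power_root
begin

lemma autocorr_ind:
  assumes "S \<subseteq> I"
  shows "autocorr (ind S) y = int (weight_enumerator n S (y mod int n))"
proof -
  let ?A = "{v \<in> I. v \<in> S \<and> (v + y) mod int n \<in> S}"
  let ?B = "{x \<in> S \<times> S. (fst x - snd x) mod int n = y mod int n}"
  have diffD: "(w + y) mod int n = v" if "(v - w) mod int n = y mod int n" "v \<in> S" for v w
  proof -
    have "(w + y) mod int n = (w + (v - w)) mod int n" using that(1) by (metis mod_add_right_eq)
    then show ?thesis using that(2) assms by auto
  qed
  have "bij_betw (\<lambda>v. ((v + y) mod int n, v)) ?A ?B"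
    using assms by (intro bij_betw_byWitness[where f' = snd]) (auto simp: mod_simps diffD)
  then have card_eq: "card ?A = card ?B" by (rule bij_betw_same_card)
  have "autocorr (ind S) y = (\<Sum>v\<in>I. if v \<in> S \<and> (v + y) mod int n \<in> S then 1 else 0)"
    unfolding autocorr_def by (rule sum.cong) (auto simp: ind_def)
  also have "\<dots> = (\<Sum>v\<in>?A. 1)" by (rule sum.inter_filter[symmetric]) simp
  also have "\<dots> = int (card ?B)" unfolding card_eq[symmetric] by simp
  finally show ?thesis by (simp only: weight_enumerator_eq_card[OF n_pos assms])
qed

text \<open>The right side of the duality relation at \<open>y\<close> is the squared modulus of the
  character sum of \<open>S\<close> at the root \<open>zeta n powi y\<close>.\<close>

lemma fsum_ind_mult_cnj:
  assumes y: "y \<in> I" and z: "z = zeta n powi y" and dual: "formally_dual n S T"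
  shows "fsum (ind S) * cnj (fsum (ind S)) =
    of_nat (card S) ^ 2 / of_nat (card T) * of_nat (weight_enumerator n T y)"
proof -
  note D = formally_dualD[OF n_pos dual]
  have "fsum (ind S) * cnj (fsum (ind S)) = fsum (autocorr (ind S))"
    by (rule fsum_mult_cnj[OF periodic_ind])
  also have "\<dots> = (\<Sum>v\<in>I. of_nat (weight_enumerator n S v) * z powi v)"
    unfolding fsum_def by (simp add: autocorr_ind[OF D(3)])
  also have "\<dots> = (\<Sum>v\<in>I. of_nat (weight_enumerator n S v) * zeta n powi (v * y))"
    by (simp add: z power_int_mult[symmetric] mult.commute)
  finally show ?thesis using D(5)[OF y] by simp
qed

text \<open>Scaling by \<open>card T\<close> keeps the coefficients integral: \<open>?c\<close>
  below evaluates to 0, so it takes equal values at 0 and at \<open>q\<close>.\<close>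

lemma weight_enumerator_q:
  assumes y: "y \<in> I" and z: "z = zeta n powi y" and dual: "formally_dual n S T"
  shows "card S ^ 2 * weight_enumerator n T y + card T * weight_enumerator n S (int q) = card T * card S"
proof -
  note D = formally_dualD[OF n_pos dual]
  have posT: "card T > 0" using D finite_subset[of T I] by (simp add: card_gt_0_iff)
  let ?c = "\<lambda>v. int (card T) * autocorr (ind S) v - int (card S ^ 2 * weight_enumerator n T y) * delta 0 v"
  have "periodic (int n) ?c"
    using periodic_autocorr[OF periodic_ind, of S] periodic_delta by (simp add: periodic_def)
  moreover have "fsum ?c = 0"
    using posT by (simp add: fsum_diff fsum_cmult fsum_delta fsum_mult_cnj[OF periodic_ind, symmetric]
        fsum_ind_mult_cnj[OF assms])
  ultimately have "?c (0 + int q * 1) = ?c 0" by (rule q_periodic_if_fsum_eq_0)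
  then have "int (card T * weight_enumerator n S (int q)) =
     int (card T * card S) - int (card S ^ 2 * weight_enumerator n T y)"
    using q_pos q_lt_n by (simp add: autocorr_ind[OF D(3)] delta_def weight_enumerator_0[OF n_pos D(3)])
  then show ?thesis by linarith
qed

end

text \<open>In the relation \<open>unit\<close> only the weight of \<open>y\<close> in
  \<open>T\<close> depends on \<open>y\<close>, so all units have the same weight. Primitivity of
  \<open>T\<close> makes it positive, and it is at most \<open>card T / card S\<close>.\<close>

lemma
  assumes "prime p" and dual: "formally_dual (p ^ Suc m) S T"
    and "\<not> in_proper_coset (p ^ Suc m) T"
  shows formally_dual_card_le: "card S \<le> card T"
    and weight_enumerator_unit: "card S = card T \<Longrightarrow> y \<in> {0..<int (p ^ Suc m)} \<Longrightarrow> \<not> int p dvd y \<Longrightarrow>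
      weight_enumerator (p ^ Suc m) T y = 1"
proof -
  define N where "N = p ^ Suc m"
  have N: "N > 0" using prime_gt_0_nat[OF assms(1)] by (simp add: N_def)
  have pn: "int p dvd int N" by (simp add: N_def)
  note D = formally_dualD[OF N dual[folded N_def]]
  have pos: "card S > 0" using D finite_subset[of S "{0..<int N}"] by (simp add: card_gt_0_iff)
  have unit: "card S ^ 2 * weight_enumerator N T y + card T * weight_enumerator N S (int (p ^ m))
      = card T * card S" if y: "y \<in> {0..<int N}" "\<not> int p dvd y" for y
  proof -
    interpret prime_power_root p m "zeta (p ^ Suc m) powi y"
      using prime_power_root_zeta assms(1) y(2) .
    show ?thesis
      using weight_enumerator_q[of y S T] y(1) dual by (simp only: N_def n_def q_def)
  qed
  obtain s t where st: "s \<in> T" "t \<in> T" "\<not> int p dvd s - t"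
    using unit_difference_if_not_in_proper_coset[OF assms(1,3) D(2)] D(4) by (auto simp: N_def)
  define u where "u = (s - t) mod int N"
  have u: "u \<in> {0..<int N}" "\<not> int p dvd u"
    using N st(3) pn by (simp_all add: u_def dvd_mod_iff)
  have "(s, t) \<in> {x \<in> T \<times> T. (fst x - snd x) mod int N = u}" using st by (simp add: u_def)
  moreover have "finite (T \<times> T)" using finite_subset[OF D(4)] by simp
  ultimately have "weight_enumerator N T u > 0"
    unfolding weight_enumerator_eq_card[OF N D(4)] by (auto simp: card_gt_0_iff)
  then have eq: "weight_enumerator N T y = weight_enumerator N T u"
    if "y \<in> {0..<int N}" "\<not> int p dvd y" for y
  proof -
    have "card S ^ 2 * weight_enumerator N T y = card S ^ 2 * weight_enumerator N T u"
      using unit[OF that] unit[OF u] by linarith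
    then show ?thesis using pos by simp
  qed
  have le: "card S * weight_enumerator N T u \<le> card T"
  proof -
    have "card S ^ 2 * weight_enumerator N T u \<le> card T * card S"
      using unit[OF u] by linarith
    then have "card S * (card S * weight_enumerator N T u) \<le> card S * card T"
      by (simp only: power2_eq_square mult.assoc mult.commute[of "card T"])
    then show ?thesis using pos by (simp only: mult_le_cancel1)
  qed
  moreover have "card S * 1 \<le> card S * weight_enumerator N T u"
    using \<open>weight_enumerator N T u > 0\<close> by (intro mult_le_mono) auto
  ultimately show "card S \<le> card T" by linarith
  show "weight_enumerator (p ^ Suc m) T y = 1"
    if "card S = card T" "y \<in> {0..<int (p ^ Suc m)}" "\<not> int p dvd y"
  proof -
    have "weight_enumerator N T u \<le> 1" using le pos that(1) by simp
    then show ?thesis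
      using eq[of y] that \<open>weight_enumerator N T u > 0\<close> by (simp add: N_def)
  qed
qed

theorem theorem1p1:
  fixes p k :: nat
  assumes "prime p" and "odd p" and "k \<ge> 1"
  shows "\<not> (\<exists>S. primitive_formal_dual (p ^ k) S)"
proof
  assume "\<exists>S. primitive_formal_dual (p ^ k) S"
  then obtain S T where dual: "formally_dual (p ^ k) S T"
    and S: "\<not> in_proper_coset (p ^ k) S" and T: "\<not> in_proper_coset (p ^ k) T"
    unfolding primitive_formal_dual_def primitive_pair_def by blast
  obtain m where m: "k = Suc m" using assms(3) by (cases k) auto
  have p1: "p > 1" using assms(1) prime_gt_1_nat by blast
  have pos: "p ^ k > 0" using p1 by simp
  note D = formally_dualD[OF pos dual]
  have dual': "formally_dual (p ^ k) T S" by (rule formally_dual_commute[OF pos dual])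
  have card_eq: "card S = card T"
    using formally_dual_card_le[OF assms(1)] dual dual' S T unfolding m by (metis le_antisym)
  have one: "\<not> int p dvd 1" using p1 by simp
  have "1 < p ^ k" unfolding m using p1 by (rule one_less_power) simp
  then have one_in: "(1 :: int) \<in> {0..<int (p ^ k)}" by (simp del: of_nat_power)
  have pk: "int p dvd int (p ^ k)" by (simp add: m)
  have T1: "weight_enumerator (p ^ k) T 1 = 1"
    using weight_enumerator_unit[OF assms(1) dual[unfolded m] T[unfolded m] card_eq] one_in one
    unfolding m by blast
  \<comment> \<open>A divisor of \<open>p ^ k\<close> is a power of \<open>p\<close>, so
    \<open>card S\<close> has the form needed for the norm argument.\<close>
  have "card S * card S = p ^ k" using formally_dual_card[OF pos dual] card_eq by simp
  then obtain a where a: "card S = p ^ a"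
    using divides_primepow_nat[OF assms(1)] by (metis dvd_triv_left)
  obtain s t where st: "s \<in> S" "t \<in> S" "\<not> int p dvd s - t"
    using unit_difference_if_not_in_proper_coset[OF assms(1) S[unfolded m] D(1)] D(3)
    unfolding m by blast
  \<comment> \<open>The root is written with exponent 1 to match the duality relation at
    \<open>y = 1\<close>, where the weight in \<open>T\<close> is 1.\<close>
  interpret prime_power_root p m "zeta (p ^ k) powi 1"
    unfolding m by (rule prime_power_root_zeta[OF assms(1) one])
  have n: "p ^ k = n" by (simp add: n_def m)
  have "fsum (ind S) * cnj (fsum (ind S)) =
      of_nat (card S) ^ 2 / of_nat (card T) * of_nat (weight_enumerator n T 1)"
    using one_in dual by (intro fsum_ind_mult_cnj) (simp_all only: n)
  then have norm: "fsum (ind S) * cnj (fsum (ind S)) = of_nat (card S)"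
    using T1 card_eq by (simp add: n power2_eq_square)
  have "autocorr (ind S) y \<le> 1" if "\<not> int p dvd y" for y
  proof -
    have "y mod int n \<in> {0..<int (p ^ k)}" "\<not> int p dvd y mod int n"
      using int_n_pos pk that by (simp_all add: n dvd_mod_iff)
    then have "weight_enumerator (p ^ k) S (y mod int n) = 1"
      using weight_enumerator_unit[OF assms(1) dual'[unfolded m] S[unfolded m] card_eq[symmetric]]
      unfolding m by blast
    then show ?thesis using autocorr_ind[of S y] D(3) by (simp add: n)
  qed
  then show False
    using no_flat_set_with_distinct_differences[OF assms(2) _ a norm st] D(3) unfolding n by blast
qed

end
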